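(* Let $U=ae_r+be_\theta+ce_z$ be an axisymmetric solution of the Euler equation on the solid torus $M$ with pressure $P$ and initial velocity $U_0=a_0e_r+b_0e_\theta+c_0e_z$, where $c_0$ is odd in $z$ and $a_0,b_0$ are even in $z$. Let $\mathfrak b_1=b_0(1,0)$ and $\mathfrak b_2=(b_0)_r(1,0)$ (values at $r=1,z=0$), and assume that $2\mathfrak b_1(\mathfrak b_1+\mathfrak b_2)=-\kappa^2<0$ and that $\mathfrak a=a_r(0,1,0)<0$ (value at $t=0,r=1,z=0$). Then either of the following is sufficient to ensure blowup of the solution in finite time: \begin{itemize} \item $-k^2\le P_{rr}(t,1,0)+3\mathfrak b_1^2\le 0$ for all time $t$, where $k$ is the positive solution of $k(k+\mathfrak a)=\kappa^2\ln 2$; or \item $P_{rr}(t,1,0)+3\mathfrak b_1^2\ge 0$ for all time $t$. \end{itemize}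
   Context: Configuration domain: $M=\{(x,y,z): x^2+y^2\le 1,\ -\pi\le z\le \pi\}/\{(x,y,-\pi)\equiv(x,y,\pi)\}$ with the flat metric and cylindrical coordinates $(r,\theta,z)$; $e_r,e_\theta,e_z$ are the usual cylindrical unit vector fields. An axisymmetric velocity field is $U=ae_r+be_\theta+ce_z$ with $a,b,c$ functions of $(t,r,z)$ only; $U$ is tangent to $\partial M$ (i.e. $a=0$ at $r=1$). The Euler equation is $U_t+U\cdot\nabla U=-\nabla P$, $\operatorname{div}U=0$, $U|_{t=0}=U_0$, where the axisymmetric pressure $P=P(t,r,z)$ is determined (up to a function of time) by $\Delta P=-\operatorname{Tr}((\nabla U)^2)$ with $\langle\nabla P,e_r\rangle=-\langle U\cdot\nabla U,e_r\rangle$ at $r=1$. Solutions are assumed smooth on their maximal interval of existence. Odd/even in $z$ refers to the reflection $z\mapsto -z$ of $z\in[-\pi,\pi]$. Subscripts $r,z,t$ denote partial derivatives; $P_{rr}(t,1,0)$ means $P_{rr}(t,r,z)$ at $r=1,z=0$. "For all time" means for all $t\ge 0$ in the interval of existence of the solution, and "blowup in finite time" means that the maximal time of existence of the smooth solution is finite. *)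

theory Defs
  imports "HOL-Analysis.Analysis"
begin

subsection \<open>Smoothness and differential operators up to the boundary\<close>

text \<open>
  All derivatives are taken within the domain (one-sided at boundary points and at time 0). They are
  unique, since every domain used below is convex with nonempty interior.
\<close>

primrec C_k_on :: "nat \<Rightarrow> 'a::euclidean_space set \<Rightarrow> ('a \<Rightarrow> 'b::real_normed_vector) \<Rightarrow> bool" where
  "C_k_on 0 S f \<longleftrightarrow> continuous_on S f"
| "C_k_on (Suc k) S f \<longleftrightarrow>
     (\<exists>f'. (\<forall>x\<in>S. (f has_derivative f' x) (at x within S)) \<and> (\<forall>v. C_k_on k S (\<lambda>x. f' x v)))"

definition smooth_on :: "'a::euclidean_space set \<Rightarrow> ('a \<Rightarrow> 'b::real_normed_vector) \<Rightarrow> bool" where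
  "smooth_on S f \<longleftrightarrow> (\<forall>k. C_k_on k S f)"

definition jacobian :: "'a::euclidean_space set \<Rightarrow> ('a \<Rightarrow> 'a) \<Rightarrow> 'a \<Rightarrow> 'a \<Rightarrow> 'a" where
  "jacobian S V x = frechet_derivative V (at x within S)"

definition grad :: "'a::euclidean_space set \<Rightarrow> ('a \<Rightarrow> real) \<Rightarrow> 'a \<Rightarrow> 'a" where
  "grad S f x = (\<Sum>i\<in>Basis. frechet_derivative f (at x within S) i *\<^sub>R i)"

definition linear_trace :: "('a::euclidean_space \<Rightarrow> 'a) \<Rightarrow> real" where
  "linear_trace L = (\<Sum>i\<in>Basis. L i \<bullet> i)"

definition divergence :: "'a::euclidean_space set \<Rightarrow> ('a \<Rightarrow> 'a) \<Rightarrow> 'a \<Rightarrow> real" where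
  "divergence S V x = linear_trace (jacobian S V x)"

definition laplacian :: "'a::euclidean_space set \<Rightarrow> ('a \<Rightarrow> real) \<Rightarrow> 'a \<Rightarrow> real" where
  "laplacian S f = divergence S (grad S f)"

definition advect :: "'a::euclidean_space set \<Rightarrow> ('a \<Rightarrow> 'a) \<Rightarrow> 'a \<Rightarrow> 'a" where
  "advect S V x = jacobian S V x (V x)"  \<comment> \<open>the vector field \<open>V \<cdot> \<nabla>V\<close>\<close>


subsection \<open>The solid torus\<close>

text \<open>
  Functions and vector fields on the flat solid torus are represented by their lifts to the infinite
  solid cylinder, which are the functions that are \<open>2 * pi\<close>-periodic in the third coordinate. Values
  outside the cylinder are irrelevant.
\<close>

definition cylinder :: "(real ^ 3) set" where
  "cylinder = {x. (x $ 1)\<^sup>2 + (x $ 2)\<^sup>2 \<le> 1}"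

definition cyl :: "real \<Rightarrow> real \<Rightarrow> real \<Rightarrow> real ^ 3" where
  "cyl r \<theta> z = vector [r * cos \<theta>, r * sin \<theta>, z]"

definition e_r :: "real \<Rightarrow> real ^ 3" where
  "e_r \<theta> = vector [cos \<theta>, sin \<theta>, 0]"

definition e_\<theta> :: "real \<Rightarrow> real ^ 3" where
  "e_\<theta> \<theta> = vector [- sin \<theta>, cos \<theta>, 0]"

definition e_z :: "real ^ 3" where
  "e_z = vector [0, 0, 1]"

definition z_periodic :: "(real ^ 3 \<Rightarrow> 'b) \<Rightarrow> bool" where
  "z_periodic f \<longleftrightarrow> (\<forall>x\<in>cylinder. f (x + (2 * pi) *\<^sub>R e_z) = f x)"


subsection \<open>Axisymmetric fields\<close>

text \<open>
  The cylindrical frame is only defined off the axis, hence the restriction to \<open>0 < r \<le> 1\<close>.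
\<close>

definition axisymmetric_field ::
    "(real ^ 3 \<Rightarrow> real ^ 3) \<Rightarrow> (real \<Rightarrow> real \<Rightarrow> real) \<Rightarrow> (real \<Rightarrow> real \<Rightarrow> real) \<Rightarrow> (real \<Rightarrow> real \<Rightarrow> real) \<Rightarrow> bool" where
  "axisymmetric_field V a b c \<longleftrightarrow>
     (\<forall>r\<in>{0<..1}. \<forall>\<theta> z. V (cyl r \<theta> z) = a r z *\<^sub>R e_r \<theta> + b r z *\<^sub>R e_\<theta> \<theta> + c r z *\<^sub>R e_z)"

definition axisymmetric_function :: "(real ^ 3 \<Rightarrow> real) \<Rightarrow> (real \<Rightarrow> real \<Rightarrow> real) \<Rightarrow> bool" where
  "axisymmetric_function f p \<longleftrightarrow> (\<forall>r\<in>{0<..1}. \<forall>\<theta> z. f (cyl r \<theta> z) = p r z)"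

definition even_z :: "(real \<Rightarrow> real \<Rightarrow> real) \<Rightarrow> bool" where
  "even_z f \<longleftrightarrow> (\<forall>r\<in>{0<..1}. \<forall>z\<in>{-pi..pi}. f r (- z) = f r z)"

definition odd_z :: "(real \<Rightarrow> real \<Rightarrow> real) \<Rightarrow> bool" where
  "odd_z f \<longleftrightarrow> (\<forall>r\<in>{0<..1}. \<forall>z\<in>{-pi..pi}. f r (- z) = - f r z)"

definition d_r :: "(real \<Rightarrow> real \<Rightarrow> real) \<Rightarrow> real \<Rightarrow> real \<Rightarrow> real" where
  "d_r f r z = vector_derivative (\<lambda>s. f s z) (at r within {0<..1})"


subsection \<open>Smooth solutions of the Euler equation\<close>

definition time_interval :: "ereal \<Rightarrow> real set" where
  "time_interval T = {t. 0 \<le> t \<and> ereal t < T}"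

text \<open>
  The pressure is only determined up to a function of time, so no regularity in time is required of
  it. The two conjuncts that determine it (Poisson equation and Neumann condition) also follow from
  the Euler equation, incompressibility and tangency.
\<close>

definition smooth_euler_solution ::
    "ereal \<Rightarrow> (real ^ 3 \<Rightarrow> real ^ 3) \<Rightarrow> (real \<Rightarrow> real ^ 3 \<Rightarrow> real ^ 3) \<Rightarrow> (real \<Rightarrow> real ^ 3 \<Rightarrow> real) \<Rightarrow> bool" where
  "smooth_euler_solution T U\<^sub>0 U P \<longleftrightarrow>
     0 < T \<and>
     smooth_on (time_interval T \<times> cylinder) (\<lambda>(t, x). U t x) \<and>
     (\<forall>x\<in>cylinder. U 0 x = U\<^sub>0 x) \<and>
     (\<forall>t\<in>time_interval T.
        z_periodic (U t) \<and> z_periodic (P t) \<and> smooth_on cylinder (P t) \<and>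
        (\<forall>x\<in>cylinder.
           vector_derivative (\<lambda>s. U s x) (at t within time_interval T) + advect cylinder (U t) x
             = - grad cylinder (P t) x \<and>
           divergence cylinder (U t) x = 0 \<and>
           laplacian cylinder (P t) x
             = - linear_trace (jacobian cylinder (U t) x \<circ> jacobian cylinder (U t) x)) \<and>
        (\<forall>\<theta> z.
           U t (cyl 1 \<theta> z) \<bullet> e_r \<theta> = 0 \<and>
           grad cylinder (P t) (cyl 1 \<theta> z) \<bullet> e_r \<theta>
             = - (advect cylinder (U t) (cyl 1 \<theta> z) \<bullet> e_r \<theta>)))"

text \<open>
  \<open>[0, T)\<close> is the maximal interval of existence of the smooth solution, so finite-time blowup of a
  maximal solution means \<open>T < \<infinity>\<close>.
\<close>

definition maximal_smooth_euler_solution ::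
    "ereal \<Rightarrow> (real ^ 3 \<Rightarrow> real ^ 3) \<Rightarrow> (real \<Rightarrow> real ^ 3 \<Rightarrow> real ^ 3) \<Rightarrow> (real \<Rightarrow> real ^ 3 \<Rightarrow> real) \<Rightarrow> bool" where
  "maximal_smooth_euler_solution T U\<^sub>0 U P \<longleftrightarrow>
     smooth_euler_solution T U\<^sub>0 U P \<and>
     \<not> (\<exists>T' U' P'. T < T' \<and> smooth_euler_solution T' U\<^sub>0 U' P' \<and>
          (\<forall>t\<in>time_interval T. \<forall>x\<in>cylinder. U' t x = U t x))"

end

theory Submission
  imports Defs
begin

text \<open>
  Suppose that the solution is global. By \<open>L\<^sup>2\<close>-uniqueness, the solution coincides with its reflection
  in \<open>z\<close>, so \<open>c = 0\<close> on the disc \<open>z = 0\<close>, and the circle \<open>r = 1, z = 0\<close> is invariant. There \<open>b\<close> is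
  constant in time, and the radial derivatives of the momentum equation close up to \<open>P\<^sub>r\<^sub>r\<close>: with
  \<open>A = a\<^sub>r\<close>, \<open>g = 2 b (b + b\<^sub>r)\<close> and \<open>q = P\<^sub>r\<^sub>r + 3 b\<^sup>2\<close>, one gets \<open>A' = - A\<^sup>2 + g - q\<close> and \<open>g' = - A g\<close>.
  Hence \<open>\<phi> = exp (\<integral> A) > 0\<close> solves \<open>\<phi>'' = - \<kappa>\<^sup>2 - q \<phi>\<close>, \<open>\<phi> 0 = 1\<close>, \<open>\<phi>' 0 < 0\<close>, and each of the two
  conditions on \<open>q\<close> forces \<open>\<phi>\<close> to become negative in finite time.
\<close>


subsection \<open>Differential inequalities and the Riccati equation\<close>

text \<open>\<open>\<phi>\<close> is the radial stretching of the particle flow map at the circle,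
  so a smooth flow keeps it positive. \<open>g\<close> is the radial derivative at
  \<open>r = 1\<close> of the squared angular momentum \<open>(r b)\<^sup>2\<close>, which particles
  carry unchanged; that is why \<open>g \<phi>\<close> is conserved, and its negative value is the
  force that drives \<open>\<phi>\<close> down. In the borderline case
  \<open>q = - k\<^sup>2\<close> the coefficient of \<open>exp (k t)\<close> in
  \<open>\<phi>\<close> has the sign of \<open>k (k + A 0) - \<kappa>\<^sup>2\<close>. The constant
  \<open>ln 2\<close> enters through \<open>ln 2 < 1\<close>, which makes this coefficient negative.
  One obstacle is that symmetry is known only at time 0, while the pressure is nonlocal and has no
  regularity in time. The energy method never differentiates it in time: at each instant the
  pressure gradient is orthogonal to divergence-free fields tangent to the boundary. The other
  obstacle is the axis, where the cylindrical frame breaks down. The estimate therefore uses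
  Cartesian components on the half plane \<theta> = 0 with weight \<open>r\<close>, whose vanishing
  also removes the boundary term at \<open>r = 0\<close>.\<close>

lemma half_line_decreasing:
  fixes f f' :: "real \<Rightarrow> real"
  assumes der: "\<And>s. 0 \<le> s \<Longrightarrow> (f has_real_derivative f' s) (at s within {0..})"
    and neg: "\<And>s. 0 \<le> s \<Longrightarrow> s \<le> t \<Longrightarrow> f' s \<le> 0" and "0 \<le> t"
  shows "f t \<le> f 0"
proof (rule DERIV_nonpos_imp_decreasing_open[OF \<open>0 \<le> t\<close>])
  show "\<exists>y. DERIV f s :> y \<and> y \<le> 0" if "0 < s" "s < t" for s
  proof -
    have "at s within {0..} = at s"
      using that by (intro at_within_interior) auto
    then show ?thesis
      using der[of s] neg[of s] that by auto
  qed
  have "continuous_on {0..} f"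
    using der by (intro DERIV_continuous_on[of "{0..}" f f']) auto
  then show "continuous_on {0..t} f"
    by (rule continuous_on_subset) auto
qed

lemma half_line_constant:
  fixes f :: "real \<Rightarrow> real"
  assumes der: "\<And>s. 0 \<le> s \<Longrightarrow> (f has_real_derivative 0) (at s within {0..})" and "0 \<le> t"
  shows "f t = f 0"
proof (rule antisym)
  show "f t \<le> f 0"
    by (rule half_line_decreasing[where f' = "\<lambda>_. 0"]) (use assms in auto)
  have "- f t \<le> - f 0"
    by (rule half_line_decreasing[where f' = "\<lambda>_. 0" and f = "\<lambda>s. - f s"])
      (use assms in \<open>auto intro!: derivative_eq_intros\<close>)
  then show "f 0 \<le> f t" by simp
qed

text \<open>The integrating factor \<open>exp (- C * s)\<close> reduces this to monotonicity.
  \<open>f\<close> may have either sign, since it is applied to a negative quantity as well as to an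
  energy. The inequality is asked for only up to \<open>t\<close>, because velocity gradients are
  bounded only on compact time intervals.\<close>

lemma half_line_gronwall:
  fixes f f' :: "real \<Rightarrow> real"
  assumes der: "\<And>s. 0 \<le> s \<Longrightarrow> (f has_real_derivative f' s) (at s within {0..})"
    and le: "\<And>s. 0 \<le> s \<Longrightarrow> s \<le> t \<Longrightarrow> f' s \<le> C * f s" and "0 \<le> t"
  shows "f t \<le> exp (C * t) * f 0"
proof -
  have "exp (- C * t) * f t \<le> exp (- C * 0) * f 0"
  proof (rule half_line_decreasing[where f = "\<lambda>s. exp (- C * s) * f s"])
    show "((\<lambda>s. exp (- C * s) * f s) has_real_derivative exp (- C * s) * (f' s - C * f s))
        (at s within {0..})" if "0 \<le> s" for s
      using der[OF that] by (auto intro!: derivative_eq_intros simp: algebra_simps)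
  qed (use le \<open>0 \<le> t\<close> in \<open>auto simp: mult_le_0_iff\<close>)
  then have "exp (C * t) * (exp (- C * t) * f t) \<le> exp (C * t) * f 0"
    by simp
  moreover have "exp (C * t) * (exp (- C * t) * f t) = f t"
    by (simp add: mult.assoc[symmetric] flip: exp_add)
  ultimately show ?thesis
    by linarith
qed

lemma half_line_integral:
  fixes f :: "real \<Rightarrow> 'a::banach"
  assumes "continuous_on {0..} f" and "0 \<le> t"
  shows "((\<lambda>s. integral {0..s} f) has_vector_derivative f t) (at t within {0..})"
proof -
  \<comment> \<open>The interval ends strictly beyond \<open>t\<close>, so near \<open>t\<close> it
    agrees with the half line.\<close>
  have "continuous_on {0..t + 1} f"
    using assms by (auto elim!: continuous_on_subset)
  then have "((\<lambda>s. integral {0..s} f) has_vector_derivative f t) (at t within {0..t + 1})"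
    using \<open>0 \<le> t\<close> by (intro integral_has_vector_derivative) auto
  moreover have "at t within {0..t + 1} = at t within {0..}"
    by (rule at_within_nhd[of _ "{..<t + 1}"]) auto
  ultimately show ?thesis by simp
qed

text \<open>
  The substitution \<open>\<phi> = exp (\<integral> A)\<close> linearises the Riccati equation: \<open>g = - \<kappa>\<^sup>2 / \<phi>\<close>, and
  \<open>\<phi>'' = - \<kappa>\<^sup>2 - q \<phi>\<close>.
\<close>

lemma riccati_linearisation:
  fixes A g q :: "real \<Rightarrow> real"
  assumes A: "\<And>t. 0 \<le> t \<Longrightarrow> (A has_real_derivative g t - q t - (A t)\<^sup>2) (at t within {0..})"
    and g: "\<And>t. 0 \<le> t \<Longrightarrow> (g has_real_derivative - A t * g t) (at t within {0..})"
  obtains \<phi> \<psi> where "\<And>t. 0 < \<phi> t" "\<phi> 0 = 1" "\<psi> 0 = A 0"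
    "\<And>t. 0 \<le> t \<Longrightarrow> (\<phi> has_real_derivative \<psi> t) (at t within {0..})"
    "\<And>t. 0 \<le> t \<Longrightarrow> (\<psi> has_real_derivative g 0 - q t * \<phi> t) (at t within {0..})"
proof -
  define \<phi> where "\<phi> t = exp (integral {0..t} A)" for t
  have "continuous_on {0..} A"
    using A by (intro DERIV_continuous_on) auto
  from half_line_integral[OF this, folded has_real_derivative_iff_has_vector_derivative]
  have \<phi>: "(\<phi> has_real_derivative A t * \<phi> t) (at t within {0..})" if "0 \<le> t" for t
    unfolding \<phi>_def using that by (auto intro!: derivative_eq_intros)
  have \<phi>0: "\<phi> 0 = 1" by (simp add: \<phi>_def)
  have g\<phi>: "g t * \<phi> t = g 0" if "0 \<le> t" for t
  proof -
    have "g t * \<phi> t = g 0 * \<phi> 0"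
      by (rule half_line_constant[of "\<lambda>t. g t * \<phi> t"])
        (use that in \<open>auto intro!: derivative_eq_intros g \<phi>\<close>)
    then show ?thesis by (simp add: \<phi>0)
  qed
  show thesis
  proof (rule that)
    show "0 < \<phi> t" for t by (simp add: \<phi>_def)
    show "(\<phi> has_real_derivative A t * \<phi> t) (at t within {0..})" if "0 \<le> t" for t
      by (rule \<phi>[OF that])
    \<comment> \<open>The quadratic term of the Riccati equation cancels against \<open>A\<close>
      times the derivative of \<open>\<phi>\<close>.\<close>
    show "((\<lambda>t. A t * \<phi> t) has_real_derivative g 0 - q t * \<phi> t) (at t within {0..})" if "0 \<le> t" for t
      unfolding g\<phi>[OF that, symmetric]
      by (auto intro!: derivative_eq_intros A \<phi> that simp: algebra_simps power2_eq_square)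
  qed (simp_all add: \<phi>0)
qed

text \<open>For nonnegative \<open>q\<close> the function \<open>\<phi>\<close> is concave, so it
  stays below its initial tangent \<open>1 + A 0 * t\<close>. The tangent reaches zero at
  \<open>t = - 1 / A 0\<close>, against the positivity of \<open>\<phi>\<close>.\<close>

lemma no_global_riccati_nonneg:
  fixes A g q :: "real \<Rightarrow> real"
  assumes A: "\<And>t. 0 \<le> t \<Longrightarrow> (A has_real_derivative g t - q t - (A t)\<^sup>2) (at t within {0..})"
    and g: "\<And>t. 0 \<le> t \<Longrightarrow> (g has_real_derivative - A t * g t) (at t within {0..})"
    and "g 0 < 0" "A 0 < 0" and q: "\<And>t. 0 \<le> t \<Longrightarrow> 0 \<le> q t"
  shows False
proof -
  obtain \<phi> \<psi> where pos: "\<And>t. 0 < \<phi> t" and ini: "\<phi> 0 = 1" "\<psi> 0 = A 0"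
    and \<phi>: "\<And>t. 0 \<le> t \<Longrightarrow> (\<phi> has_real_derivative \<psi> t) (at t within {0..})"
    and \<psi>: "\<And>t. 0 \<le> t \<Longrightarrow> (\<psi> has_real_derivative g 0 - q t * \<phi> t) (at t within {0..})"
    using riccati_linearisation[OF A g] by blast
  have \<psi>_le: "\<psi> t \<le> A 0" if "0 \<le> t" for t
  proof -
    have "g 0 - q s * \<phi> s \<le> 0" if "0 \<le> s" for s
      using q[OF that] pos[of s] \<open>g 0 < 0\<close> mult_nonneg_nonneg[of "q s" "\<phi> s"] by linarith
    then show ?thesis
      using half_line_decreasing[OF \<psi>, of t] that ini by simp
  qed
  define t where "t = - 1 / A 0"
  have "0 \<le> t" using \<open>A 0 < 0\<close> by (simp add: t_def)
  have "\<phi> t - A 0 * t \<le> \<phi> 0 - A 0 * 0"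
    by (rule half_line_decreasing[where f' = "\<lambda>s. \<psi> s - A 0" and f = "\<lambda>s. \<phi> s - A 0 * s"])
      (use \<psi>_le \<open>0 \<le> t\<close> in \<open>auto intro!: derivative_eq_intros \<phi>\<close>)
  moreover have "A 0 * t = - 1" using \<open>A 0 < 0\<close> by (simp add: t_def)
  ultimately show False using pos[of t] ini by simp
qed

text \<open>The combination \<open>\<psi> + k \<phi>\<close> isolates the growing mode of \<open>\<phi>'' = k\<^sup>2 \<phi> - \<kappa>\<^sup>2\<close>.\<close>

lemma no_global_riccati_bounded_below:
  fixes A g q :: "real \<Rightarrow> real"
  assumes A: "\<And>t. 0 \<le> t \<Longrightarrow> (A has_real_derivative g t - q t - (A t)\<^sup>2) (at t within {0..})"
    and g: "\<And>t. 0 \<le> t \<Longrightarrow> (g has_real_derivative - A t * g t) (at t within {0..})"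
    and "0 < k" and small: "k * (k + A 0) < - g 0" and q: "\<And>t. 0 \<le> t \<Longrightarrow> - k\<^sup>2 \<le> q t"
  shows False
proof -
  obtain \<phi> \<psi> where pos: "\<And>t. 0 < \<phi> t" and ini: "\<phi> 0 = 1" "\<psi> 0 = A 0"
    and \<phi>: "\<And>t. 0 \<le> t \<Longrightarrow> (\<phi> has_real_derivative \<psi> t) (at t within {0..})"
    and \<psi>: "\<And>t. 0 \<le> t \<Longrightarrow> (\<psi> has_real_derivative g 0 - q t * \<phi> t) (at t within {0..})"
    using riccati_linearisation[OF A g] by blast
  \<comment> \<open>\<open>- \<delta>\<close> is the initial value of
    \<open>\<psi> + k * \<phi> + g 0 / k\<close>. The constant \<open>g 0 / k\<close> absorbs the
    forcing: the derivative of this sum minus \<open>k\<close> times the sum is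
    \<open>- (q + k\<^sup>2) * \<phi>\<close>, which is at most 0.\<close>
  define \<delta> where "\<delta> = - g 0 / k - (k + A 0)"
  have "0 < \<delta>" using small \<open>0 < k\<close> by (simp add: \<delta>_def field_simps)
  have \<delta>k: "- \<delta> = A 0 + k + g 0 / k" by (simp add: \<delta>_def)
  have w: "\<psi> t + k * \<phi> t + g 0 / k \<le> - \<delta> * exp (k * t)" if "0 \<le> t" for t
  proof -
    have "\<psi> t + k * \<phi> t + g 0 / k \<le> exp (k * t) * (\<psi> 0 + k * \<phi> 0 + g 0 / k)"
    proof (rule half_line_gronwall[where f = "\<lambda>t. \<psi> t + k * \<phi> t + g 0 / k"])
      show "((\<lambda>t. \<psi> t + k * \<phi> t + g 0 / k) has_real_derivative g 0 - q s * \<phi> s + k * \<psi> s)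
          (at s within {0..})" if "0 \<le> s" for s
        by (auto intro!: derivative_eq_intros \<phi> \<psi> that)
      show "g 0 - q s * \<phi> s + k * \<psi> s \<le> k * (\<psi> s + k * \<phi> s + g 0 / k)" if "0 \<le> s" for s
        using mult_right_mono[OF q[OF that], of "\<phi> s"] pos[of s] \<open>0 < k\<close>
        by (simp add: algebra_simps power2_eq_square)
    qed fact
    then show ?thesis using ini \<delta>k by (simp add: mult.commute)
  qed
  \<comment> \<open>Multiplied by \<open>exp (k * s)\<close>, the bound \<open>w\<close> says that
    the derivative of \<open>exp (k * s) * (\<phi> s + g 0 / k\<^sup>2)\<close> is at most
    \<open>- \<delta> * exp (2 * k * s)\<close>. \<open>F\<close> moves both sides into one
    primitive, so it cannot increase.\<close>
  define F where "F s = exp (k * s) * (\<phi> s + g 0 / k\<^sup>2) + \<delta> * (exp (2 * k * s) / (2 * k))" for s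
  have F: "F s \<le> F 0" if "0 \<le> s" for s
  proof (rule half_line_decreasing[OF _ _ that])
    show "(F has_real_derivative exp (k * s) * (\<psi> s + k * \<phi> s + g 0 / k + \<delta> * exp (k * s)))
        (at s within {0..})" if "0 \<le> s" for s
      unfolding F_def using \<open>0 < k\<close>
      by (auto intro!: derivative_eq_intros \<phi> that
          simp: field_simps power2_eq_square simp flip: exp_add)
    show "exp (k * s) * (\<psi> s + k * \<phi> s + g 0 / k + \<delta> * exp (k * s)) \<le> 0" if "0 \<le> s" for s
      using w[OF that] by (simp add: mult_le_0_iff)
  qed
  \<comment> \<open>Once \<open>exp (k * s)\<close> exceeds \<open>C\<close>, the term with \<delta>
    outweighs the two constants in \<open>F s \<le> F 0\<close> and forces \<open>\<phi> s\<close>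
    to be negative. The choice of \<open>s\<close> gives \<open>1 + k * s = C + 2\<close>, hence
    \<open>exp (k * s) > C\<close>.\<close>
  define C where "C = 2 * k / \<delta> * (\<bar>F 0\<bar> + \<bar>g 0 / k\<^sup>2\<bar>)"
  define s where "s = (C + 1) / k"
  have "0 \<le> C" using \<open>0 < k\<close> \<open>0 < \<delta>\<close> by (simp add: C_def)
  then have "0 \<le> s" using \<open>0 < k\<close> by (simp add: s_def)
  let ?e = "exp (k * s)"
  have "1 + k * s \<le> ?e" by (rule exp_ge_add_one_self)
  then have e: "C < ?e" "1 \<le> ?e" using \<open>0 < k\<close> \<open>0 \<le> C\<close> by (auto simp: s_def)
  have "exp (2 * k * s) = ?e * ?e" by (simp flip: exp_add)
  then have "?e * (g 0 / k\<^sup>2) + \<delta> * (?e * ?e / (2 * k)) < F 0"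
    using F[OF \<open>0 \<le> s\<close>] mult_pos_pos[OF exp_gt_zero pos, of "k * s" s]
    unfolding F_def[of s] distrib_left by simp
  moreover have "F 0 \<le> ?e * \<bar>F 0\<bar>"
    using mult_right_mono[OF e(2), of "\<bar>F 0\<bar>"] by simp
  ultimately have "?e * (g 0 / k\<^sup>2 + \<delta> * ?e / (2 * k)) < ?e * \<bar>F 0\<bar>"
    by (simp add: distrib_left mult.left_commute)
  then have "g 0 / k\<^sup>2 + \<delta> * ?e / (2 * k) < \<bar>F 0\<bar>"
    by simp
  then have "\<delta> * ?e / (2 * k) < \<bar>F 0\<bar> + \<bar>g 0 / k\<^sup>2\<bar>" by linarith
  then have "?e < C"
    using \<open>0 < k\<close> \<open>0 < \<delta>\<close> by (simp add: C_def field_simps)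
  with e show False by simp
qed

text \<open>Derivatives at the boundary of the cylinder are one-sided, so uniqueness has to come
  from convexity. Along the chord from \<open>x\<close> to any point \<open>y\<close> of
  \<open>S\<close> both derivatives must agree on \<open>y - x\<close>. For \<open>y\<close>
  interior, \<open>y\<close> and \<open>y + d *\<^sub>R v\<close> both lie in \<open>S\<close>, and
  subtracting their chords leaves a multiple of \<open>v\<close>.\<close>

lemma has_derivative_unique_convex:
  fixes f :: "'a::euclidean_space \<Rightarrow> 'b::real_normed_vector"
  assumes "convex S" "interior S \<noteq> {}" "x \<in> S"
    and f1: "(f has_derivative L1) (at x within S)" and f2: "(f has_derivative L2) (at x within S)"
  shows "L1 = L2"
proof
  fix v :: 'a
  interpret L1: bounded_linear L1 by (rule has_derivative_bounded_linear[OF f1])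
  interpret L2: bounded_linear L2 by (rule has_derivative_bounded_linear[OF f2])
  have chord: "L1 (y - x) = L2 (y - x)" if "y \<in> S" for y
  proof -
    let ?c = "\<lambda>s::real. x + s *\<^sub>R (y - x)"
    have c: "(?c has_vector_derivative y - x) (at 0 within {0..1})"
      by (auto intro!: derivative_eq_intros)
    have sub: "?c ` {0..1} \<subseteq> S"
    proof clarify
      fix s :: real assume "s \<in> {0..1}"
      then have "(1 - s) *\<^sub>R x + s *\<^sub>R y \<in> S"
        using assms(1,3) that by (intro convexD) auto
      then show "?c s \<in> S" by (simp add: algebra_simps)
    qed
    have "((f \<circ> ?c) has_vector_derivative L (y - x)) (at 0 within {0..1})"
      if "(f has_derivative L) (at x within S)" for L
      using vector_derivative_diff_chain_within[OF c, of f L] has_derivative_subset[OF that sub] by simp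
    from this[OF f1] this[OF f2] show ?thesis
      by (rule vector_derivative_unique_within[rotated]) (simp add: at_within_Icc_at_right)
  qed
  obtain y e where "0 < e" and ball: "ball y e \<subseteq> S"
    using assms(2) by (auto simp: mem_interior)
  define d where "d = e / (2 * (norm v + 1))"
  have "0 < d" using \<open>0 < e\<close> by (auto simp: d_def intro!: divide_pos_pos add_nonneg_pos)
  have "d * norm v < e"
    using \<open>0 < e\<close> norm_ge_zero[of v] by (simp add: d_def field_simps add_nonneg_pos add_pos_nonneg)
  then have "y + d *\<^sub>R v \<in> S" "y \<in> S"
    using ball \<open>0 < d\<close> \<open>0 < e\<close> by (auto simp: subset_eq dist_norm)
  from chord[OF this(1)] chord[OF this(2)]
  have "L1 ((y + d *\<^sub>R v - x) - (y - x)) = L2 ((y + d *\<^sub>R v - x) - (y - x))"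
    unfolding L1.diff L2.diff by simp
  then show "L1 v = L2 v"
    using \<open>0 < d\<close> by (simp add: L1.scaleR L2.scaleR)
qed

text \<open>By Fubini, \<open>F'\<close> may be integrated first in \<open>x\<close> and
  \<open>G'\<close> first in \<open>y\<close>; equal values on opposite sides make both inner
  integrals vanish.\<close>

lemma integral_divergence_rectangle:
  fixes F F' G G' :: "real \<Rightarrow> real \<Rightarrow> real"
  assumes "a \<le> b" "c \<le> d"
    and F: "\<And>x y. x \<in> {a..b} \<Longrightarrow> y \<in> {c..d} \<Longrightarrow>
      ((\<lambda>x. F x y) has_real_derivative F' x y) (at x within {a..b})"
    and G: "\<And>x y. x \<in> {a..b} \<Longrightarrow> y \<in> {c..d} \<Longrightarrow>
      ((\<lambda>y. G x y) has_real_derivative G' x y) (at y within {c..d})"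
    and F': "continuous_on (cbox (a, c) (b, d)) (\<lambda>(x, y). F' x y)"
    and G': "continuous_on (cbox (a, c) (b, d)) (\<lambda>(x, y). G' x y)"
    and bF: "\<And>y. y \<in> {c..d} \<Longrightarrow> F a y = F b y" and bG: "\<And>x. x \<in> {a..b} \<Longrightarrow> G x c = G x d"
  shows "((\<lambda>(x, y). F' x y + G' x y) has_integral 0) (cbox (a, c) (b, d))"
proof -
  have "integral (cbox a b) (\<lambda>x. F' x y) = 0" if "y \<in> {c..d}" for y
    using fundamental_theorem_of_calculus[OF \<open>a \<le> b\<close>, of "\<lambda>x. F x y" "\<lambda>x. F' x y"] F[OF _ that] bF[OF that]
    by (simp add: has_real_derivative_iff_has_vector_derivative has_integral_iff)
  moreover have "integral (cbox (a, c) (b, d)) (\<lambda>(x, y). F' x y)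
      = integral (cbox c d) (\<lambda>y. integral (cbox a b) (\<lambda>x. F' x y))"
    using integral_prod_continuous[OF F'] integral_swap_continuous[OF F'] by simp
  ultimately have 1: "integral (cbox (a, c) (b, d)) (\<lambda>(x, y). F' x y) = 0"
    using integral_cong[of "{c..d}" "\<lambda>y. integral {a..b} (\<lambda>x. F' x y)" "\<lambda>_. 0"] by simp
  have "integral (cbox c d) (\<lambda>y. G' x y) = 0" if "x \<in> {a..b}" for x
    using fundamental_theorem_of_calculus[OF \<open>c \<le> d\<close>, of "\<lambda>y. G x y" "\<lambda>y. G' x y"] G[OF that] bG[OF that]
    by (simp add: has_real_derivative_iff_has_vector_derivative has_integral_iff)
  then have 2: "integral (cbox (a, c) (b, d)) (\<lambda>(x, y). G' x y) = 0"
    using integral_prod_continuous[OF G'] integral_cong[of "{a..b}" "\<lambda>x. integral {c..d} (\<lambda>y. G' x y)" "\<lambda>_. 0"]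
    by simp
  from 1 2 have "((\<lambda>(x, y). F' x y) has_integral 0) (cbox (a, c) (b, d))"
      "((\<lambda>(x, y). G' x y) has_integral 0) (cbox (a, c) (b, d))"
    using integrable_continuous[OF F'] integrable_continuous[OF G'] by (auto simp: has_integral_iff)
  from has_integral_add[OF this] show ?thesis
    by (simp add: case_prod_beta')
qed


subsection \<open>Energy uniqueness in the meridian half plane\<close>

text \<open>By \<open>div\<close>, the field (\<alpha>, \<gamma>) is divergence-free for the measure
  r dr dz, so the integrand is the plane divergence of \<open>r * f\<close> times this field. The
  flux vanishes at \<open>r = 0\<close> through the weight and at \<open>r = 1\<close> through
  tangency, and it cancels between the two ends in \<open>z\<close>. It serves for the transport of
  the energy density and for the work of the pressure.\<close>

lemma integral_transport_zero:
  fixes \<alpha> \<alpha>r \<gamma> \<gamma>z f fr fz :: "real \<Rightarrow> real \<Rightarrow> real"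
  assumes "c \<le> d"
    and \<alpha>: "\<And>r z. r \<in> {0..1} \<Longrightarrow> z \<in> {c..d} \<Longrightarrow>
      ((\<lambda>r. \<alpha> r z) has_real_derivative \<alpha>r r z) (at r within {0..1})"
    and \<gamma>: "\<And>r z. r \<in> {0..1} \<Longrightarrow> z \<in> {c..d} \<Longrightarrow>
      ((\<lambda>z. \<gamma> r z) has_real_derivative \<gamma>z r z) (at z within {c..d})"
    and fr: "\<And>r z. r \<in> {0..1} \<Longrightarrow> z \<in> {c..d} \<Longrightarrow>
      ((\<lambda>r. f r z) has_real_derivative fr r z) (at r within {0..1})"
    and fz: "\<And>r z. r \<in> {0..1} \<Longrightarrow> z \<in> {c..d} \<Longrightarrow>
      ((\<lambda>z. f r z) has_real_derivative fz r z) (at z within {c..d})"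
    and [continuous_intros]:
      "continuous_on (cbox (0, c) (1, d)) (\<lambda>x. \<alpha> (fst x) (snd x))"
      "continuous_on (cbox (0, c) (1, d)) (\<lambda>x. \<alpha>r (fst x) (snd x))"
      "continuous_on (cbox (0, c) (1, d)) (\<lambda>x. \<gamma> (fst x) (snd x))"
      "continuous_on (cbox (0, c) (1, d)) (\<lambda>x. \<gamma>z (fst x) (snd x))"
      "continuous_on (cbox (0, c) (1, d)) (\<lambda>x. f (fst x) (snd x))"
      "continuous_on (cbox (0, c) (1, d)) (\<lambda>x. fr (fst x) (snd x))"
      "continuous_on (cbox (0, c) (1, d)) (\<lambda>x. fz (fst x) (snd x))"
    and div: "\<And>r z. r \<in> {0..1} \<Longrightarrow> z \<in> {c..d} \<Longrightarrow> \<alpha> r z + r * \<alpha>r r z + r * \<gamma>z r z = 0"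
    and bnd: "\<And>z. z \<in> {c..d} \<Longrightarrow> \<alpha> 1 z = 0"
      "\<And>r. r \<in> {0..1} \<Longrightarrow> \<gamma> r c = \<gamma> r d" "\<And>r. r \<in> {0..1} \<Longrightarrow> f r c = f r d"
  shows "((\<lambda>(r, z). r * (\<alpha> r z * fr r z + \<gamma> r z * fz r z)) has_integral 0) (cbox (0, c) (1, d))"
proof -
  let ?F = "\<lambda>r z. r * \<alpha> r z * f r z" and ?G = "\<lambda>r z. r * \<gamma> r z * f r z"
  let ?F' = "\<lambda>r z. (\<alpha> r z + r * \<alpha>r r z) * f r z + r * \<alpha> r z * fr r z"
  let ?G' = "\<lambda>r z. r * \<gamma>z r z * f r z + r * \<gamma> r z * fz r z"
  have "((\<lambda>(r, z). ?F' r z + ?G' r z) has_integral 0) (cbox (0, c) (1, d))"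
  proof (rule integral_divergence_rectangle[where F = ?F and G = ?G])
    show "((\<lambda>r. ?F r z) has_real_derivative ?F' r z) (at r within {0..1})"
      if "r \<in> {0..1}" "z \<in> {c..d}" for r z
      by (auto intro!: derivative_eq_intros \<alpha>[OF that] fr[OF that] simp: algebra_simps)
    show "((\<lambda>z. ?G r z) has_real_derivative ?G' r z) (at z within {c..d})"
      if "r \<in> {0..1}" "z \<in> {c..d}" for r z
      by (auto intro!: derivative_eq_intros \<gamma>[OF that] fz[OF that] simp: algebra_simps)
    show "continuous_on (cbox (0, c) (1, d)) (\<lambda>(r, z). ?F' r z)"
        "continuous_on (cbox (0, c) (1, d)) (\<lambda>(r, z). ?G' r z)"
      unfolding case_prod_beta by (intro continuous_intros)+
  qed (use bnd \<open>c \<le> d\<close> in auto)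
  then show ?thesis
  proof (rule has_integral_eq[rotated])
    fix x :: "real \<times> real"
    assume "x \<in> cbox (0, c) (1, d)"
    moreover obtain r z where x: "x = (r, z)" by (cases x)
    ultimately have rz: "r \<in> {0..1}" "z \<in> {c..d}" by auto
    have "?F' r z + ?G' r z
        = (\<alpha> r z + r * \<alpha>r r z + r * \<gamma>z r z) * f r z + r * (\<alpha> r z * fr r z + \<gamma> r z * fz r z)"
      by (simp add: algebra_simps)
    then show "(case x of (r, z) \<Rightarrow> ?F' r z + ?G' r z)
        = (case x of (r, z) \<Rightarrow> r * (\<alpha> r z * fr r z + \<gamma> r z * fz r z))"
      by (simp add: div[OF rz] x)
  qed
qed

lemma continuous_on_time_slice:
  assumes "continuous_on ({0..} \<times> {0..1} \<times> UNIV) (\<lambda>(t, r, z). g t r z)" and "0 \<le> (t::real)"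
  shows "continuous_on (cbox (0::real, c::real) (1, d)) (\<lambda>x. g t (fst x) (snd x))"
proof -
  have "continuous_on (cbox (0, c) (1, d)) (\<lambda>x. (\<lambda>(t, r, z). g t r z) (t, fst x, snd x))"
    using \<open>0 \<le> t\<close> by (intro continuous_on_compose2[OF assms(1)] continuous_intros) auto
  then show ?thesis by (simp add: case_prod_beta')
qed

text \<open>
  The meridian half plane \<open>\<theta> = 0\<close> of an axisymmetric Euler flow: \<open>us\<close> is the derivative of the
  velocity in the Cartesian direction \<open>e\<^sub>\<theta>(0)\<close>, so that \<open>r *\<^sub>R us\<close> is its \<open>\<theta>\<close>-derivative. Unlike
  \<open>a / r\<close> and \<open>b / r\<close>, it is continuous up to the axis.
\<close>

locale axisymmetric_euler =
  fixes u ut ur us uz :: "real \<Rightarrow> real \<Rightarrow> real \<Rightarrow> real ^ 3"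
    and p pr pz :: "real \<Rightarrow> real \<Rightarrow> real \<Rightarrow> real"
  assumes cont:
      "continuous_on ({0..} \<times> {0..1} \<times> UNIV) (\<lambda>(t, r, z). u t r z)"
      "continuous_on ({0..} \<times> {0..1} \<times> UNIV) (\<lambda>(t, r, z). ut t r z)"
      "continuous_on ({0..} \<times> {0..1} \<times> UNIV) (\<lambda>(t, r, z). ur t r z)"
      "continuous_on ({0..} \<times> {0..1} \<times> UNIV) (\<lambda>(t, r, z). us t r z)"
      "continuous_on ({0..} \<times> {0..1} \<times> UNIV) (\<lambda>(t, r, z). uz t r z)"
    and cont_pressure:
      "0 \<le> t \<Longrightarrow> continuous_on ({0..1} \<times> UNIV) (\<lambda>(r, z). p t r z)"
      "0 \<le> t \<Longrightarrow> continuous_on ({0..1} \<times> UNIV) (\<lambda>(r, z). pr t r z)"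
      "0 \<le> t \<Longrightarrow> continuous_on ({0..1} \<times> UNIV) (\<lambda>(r, z). pz t r z)"
    and deriv_t: "0 \<le> t \<Longrightarrow> r \<in> {0..1} \<Longrightarrow>
      ((\<lambda>t. u t r z) has_vector_derivative ut t r z) (at t within {0..})"
    and deriv_r: "0 \<le> t \<Longrightarrow> r \<in> {0..1} \<Longrightarrow>
      ((\<lambda>r. u t r z) has_vector_derivative ur t r z) (at r within {0..1})"
    and deriv_z: "0 \<le> t \<Longrightarrow> r \<in> {0..1} \<Longrightarrow>
      ((\<lambda>z. u t r z) has_vector_derivative uz t r z) (at z)"
    and pressure_r: "0 \<le> t \<Longrightarrow> r \<in> {0..1} \<Longrightarrow>
      ((\<lambda>r. p t r z) has_real_derivative pr t r z) (at r within {0..1})"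
    and pressure_z: "0 \<le> t \<Longrightarrow> r \<in> {0..1} \<Longrightarrow>
      ((\<lambda>z. p t r z) has_real_derivative pz t r z) (at z)"
    and swirl: "0 \<le> t \<Longrightarrow> 0 < r \<Longrightarrow> r \<le> 1 \<Longrightarrow>
      r *\<^sub>R us t r z = vector [- (u t r z $ 2), u t r z $ 1, 0]"
    and momentum: "0 \<le> t \<Longrightarrow> 0 < r \<Longrightarrow> r \<le> 1 \<Longrightarrow>
      ut t r z + ((u t r z $ 1) *\<^sub>R ur t r z + (u t r z $ 2) *\<^sub>R us t r z + (u t r z $ 3) *\<^sub>R uz t r z)
        = - vector [pr t r z, 0, pz t r z]"
    and incompressible: "0 \<le> t \<Longrightarrow> r \<in> {0..1} \<Longrightarrow>
      ur t r z $ 1 + us t r z $ 2 + uz t r z $ 3 = 0"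
    and tangent: "0 \<le> t \<Longrightarrow> u t 1 z $ 1 = 0"
    and periodic: "0 \<le> t \<Longrightarrow> r \<in> {0..1} \<Longrightarrow> u t r (- pi) = u t r pi"
      "0 \<le> t \<Longrightarrow> r \<in> {0..1} \<Longrightarrow> p t r (- pi) = p t r pi"
begin

lemmas cont_slice = cont[THEN continuous_on_time_slice]

lemma cont_pressure_slice:
  assumes "0 \<le> t"
  shows "continuous_on (cbox (0, c) (1, d)) (\<lambda>x. p t (fst x) (snd x))"
    "continuous_on (cbox (0, c) (1, d)) (\<lambda>x. pr t (fst x) (snd x))"
    "continuous_on (cbox (0, c) (1, d)) (\<lambda>x. pz t (fst x) (snd x))"
  using cont_pressure[OF assms]
  by (auto simp: case_prod_beta elim!: continuous_on_subset)

text \<open>Multiplying by \<open>r\<close> trades \<open>r * us t r z $ 2\<close> for the radial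
  velocity. This is the form \<open>div\<close> of \<open>integral_transport_zero\<close>, extended
  to the axis, where \<open>swirl\<close> gives no information directly.\<close>

lemma weighted_incompressible:
  assumes "0 \<le> t" "r \<in> {0..1}"
  shows "u t r z $ 1 + r * ur t r z $ 1 + r * uz t r z $ 3 = 0"
proof (cases "r = 0")
  case True
  \<comment> \<open>on the axis, the radial velocity vanishes as a limit of \<open>r * us t r z $ 2\<close>\<close>
  have "continuous_on {0..1} (\<lambda>r. u t r z)" "continuous_on {0..1} (\<lambda>r. us t r z)"
    using assms(1) continuous_on_compose2[OF cont(1), of "{0..1}" "\<lambda>r. (t, r, z)"]
      continuous_on_compose2[OF cont(4), of "{0..1}" "\<lambda>r. (t, r, z)"]
    by (auto simp: continuous_on_Pair)
  then have "continuous_on {0..1} (\<lambda>r. u t r z $ 1 - r * us t r z $ 2)"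
    by (intro continuous_intros)
  then have "((\<lambda>r. u t r z $ 1 - r * us t r z $ 2) \<longlongrightarrow> u t 0 z $ 1 - 0 * us t 0 z $ 2) (at 0 within {0..1})"
    unfolding continuous_on by (rule bspec) simp
  moreover have "eventually (\<lambda>r. u t r z $ 1 - r * us t r z $ 2 = 0) (at 0 within {0..1})"
  proof -
    have "u t r z $ 1 - r * us t r z $ 2 = 0" if "0 < r" "r \<le> 1" for r
      using arg_cong[OF swirl[OF assms(1) that, of z], of "\<lambda>v. v $ 2"] by simp
    then show ?thesis
      by (auto simp: eventually_at_filter)
  qed
  ultimately have "((\<lambda>_. 0) \<longlongrightarrow> u t 0 z $ 1 - 0 * us t 0 z $ 2) (at (0::real) within {0..1})"
    by (rule Lim_transform_eventually)
  then have "u t 0 z $ 1 = 0"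
    by (simp add: tendsto_const_iff at_within_Icc_at_right)
  then show ?thesis using True by simp
next
  case False
  then have "0 < r" "r \<le> 1" using assms by auto
  then have "u t r z $ 1 = r * us t r z $ 2"
    using arg_cong[OF swirl[OF assms(1), of r z], of "\<lambda>v. v $ 2"] by simp
  then show ?thesis
    using arg_cong[OF incompressible[OF assms, of z], of "\<lambda>x. r * x"] by (simp add: algebra_simps)
qed

end

section \<open>Energy estimate for the difference of two flows\<close>

lemma vec3_inner: "x \<bullet> y = x $ 1 * y $ 1 + x $ 2 * y $ 2 + x $ 3 * y $ 3" for x y :: "real ^ 3"
  by (simp add: inner_vec_def sum_3)

lemma has_vector_derivative_vec_nth:
  assumes "(f has_vector_derivative f') F"
  shows "((\<lambda>x. f x $ i) has_real_derivative f' $ i) F"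
  using bounded_linear.has_vector_derivative[OF bounded_linear_vec_nth assms]
  by (simp add: has_real_derivative_iff_has_vector_derivative)

lemma has_real_derivative_inner_self:
  assumes "(f has_vector_derivative f') (at x within S)"
  shows "((\<lambda>x. f x \<bullet> f x) has_real_derivative 2 * (f x \<bullet> f')) (at x within S)"
  using bounded_bilinear.has_vector_derivative[OF bounded_bilinear_inner assms assms]
  by (simp add: has_real_derivative_iff_has_vector_derivative inner_commute)

lemma bounded_on_time_slab:
  fixes g :: "real \<Rightarrow> real \<Rightarrow> real \<Rightarrow> real ^ 3"
  assumes "continuous_on ({0..} \<times> {0..1} \<times> UNIV) (\<lambda>(t, r, z). g t r z)"
  obtains K where "\<And>t r z. t \<in> {0..T} \<Longrightarrow> r \<in> {0..1} \<Longrightarrow> z \<in> {c..d} \<Longrightarrow> norm (g t r z) \<le> K"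
proof -
  let ?S = "{0..T} \<times> {0..1} \<times> {c..d}"
  have "compact ((\<lambda>(t, r, z). g t r z) ` ?S)"
    by (intro compact_continuous_image continuous_on_subset[OF assms] compact_Times) auto
  then obtain K where "\<forall>x\<in>(\<lambda>(t, r, z). g t r z) ` ?S. norm x \<le> K"
    by (meson compact_imp_bounded bounded_iff)
  then show thesis
    by (intro that[of K]) force
qed

text \<open>For w = u - v, the momentum equations give: w_t plus transport of w by u plus transport
  of v by w equals minus the gradient of p - q. Tested against 2 r w, the transport by u and the
  pressure integrate to zero. What remains has three terms, each at most \<open>K\<close> times the
  energy density; the factor 2 makes the constant 6.\<close>

lemma axisymmetric_euler_energy_inequality:
  assumes "axisymmetric_euler u ut ur us uz p pr pz" and "axisymmetric_euler v vt vr vs vz q qr qz"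
    and t: "0 \<le> t"
    and K: "\<And>r z. r \<in> {0..1} \<Longrightarrow> z \<in> {-pi..pi} \<Longrightarrow>
      norm (vr t r z) \<le> K \<and> norm (vs t r z) \<le> K \<and> norm (vz t r z) \<le> K"
  shows "integral (cbox (0, -pi) (1, pi)) (\<lambda>(r, z). r * (2 * ((u t r z - v t r z) \<bullet> (ut t r z - vt t r z))))
    \<le> 6 * K * integral (cbox (0, -pi) (1, pi)) (\<lambda>(r, z). r * ((u t r z - v t r z) \<bullet> (u t r z - v t r z)))"
proof -
  interpret u: axisymmetric_euler u ut ur us uz p pr pz by fact
  interpret v: axisymmetric_euler v vt vr vs vz q qr qz by fact
  note [continuous_intros] = u.cont_slice[OF t] v.cont_slice[OF t]
    u.cont_pressure_slice[OF t] v.cont_pressure_slice[OF t]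
  let ?Q = "cbox (0, -pi) (1, pi) :: (real \<times> real) set"
  define w where "w r z = u t r z - v t r z" for r z
  define wr where "wr r z = ur t r z - vr t r z" for r z
  define wz where "wz r z = uz t r z - vz t r z" for r z
  have w_r: "((\<lambda>r. w r z) has_vector_derivative wr r z) (at r within {0..1})" if "r \<in> {0..1}" for r z
    unfolding w_def wr_def by (intro derivative_intros u.deriv_r v.deriv_r t that)
  have w_z: "((\<lambda>z. w r z) has_vector_derivative wz r z) (at z within S)" if "r \<in> {0..1}" for r z S
    unfolding w_def wz_def
    by (intro derivative_intros u.deriv_z[THEN has_vector_derivative_at_within]
        v.deriv_z[THEN has_vector_derivative_at_within] t that)
  have 1: "((\<lambda>(r, z). r * (u t r z $ 1 * (w r z \<bullet> wr r z) + u t r z $ 3 * (w r z \<bullet> wz r z))) has_integral 0) ?Q"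
  proof (rule integral_transport_zero[where f = "\<lambda>r z. (w r z \<bullet> w r z) / 2"
        and \<alpha>r = "\<lambda>r z. ur t r z $ 1" and \<gamma>z = "\<lambda>r z. uz t r z $ 3"])
    show "((\<lambda>r. (w r z \<bullet> w r z) / 2) has_real_derivative w r z \<bullet> wr r z) (at r within {0..1})"
      if "r \<in> {0..1}" for r z
      using DERIV_cdivide[OF has_real_derivative_inner_self[OF w_r[OF that]], where c = 2] by simp
    show "((\<lambda>z. (w r z \<bullet> w r z) / 2) has_real_derivative w r z \<bullet> wz r z) (at z within {-pi..pi})"
      if "r \<in> {0..1}" for r z
      using DERIV_cdivide[OF has_real_derivative_inner_self[OF w_z[OF that]], where c = 2] by simp
    show "((\<lambda>z. u t r z $ 3) has_real_derivative uz t r z $ 3) (at z within {-pi..pi})"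
      if "r \<in> {0..1}" for r z
      by (intro has_vector_derivative_vec_nth has_vector_derivative_at_within[OF u.deriv_z] t that)
  qed (use t u.tangent u.periodic v.periodic u.weighted_incompressible
      in \<open>auto intro!: has_vector_derivative_vec_nth u.deriv_r continuous_intros simp: w_def wr_def wz_def\<close>)
  have 2: "((\<lambda>(r, z). r * (w r z $ 1 * (pr t r z - qr t r z) + w r z $ 3 * (pz t r z - qz t r z))) has_integral 0) ?Q"
  proof (rule integral_transport_zero[where f = "\<lambda>r z. p t r z - q t r z"
        and \<alpha>r = "\<lambda>r z. wr r z $ 1" and \<gamma>z = "\<lambda>r z. wz r z $ 3"])
    show "((\<lambda>z. p t r z - q t r z) has_real_derivative pz t r z - qz t r z) (at z within {-pi..pi})"
      if "r \<in> {0..1}" for r z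
      by (intro DERIV_diff has_field_derivative_at_within[OF u.pressure_z]
          has_field_derivative_at_within[OF v.pressure_z] t that)
    show "w r z $ 1 + r * wr r z $ 1 + r * wz r z $ 3 = 0" if "r \<in> {0..1}" for r z
      using u.weighted_incompressible[OF t that, of z] v.weighted_incompressible[OF t that, of z]
      by (simp add: w_def wr_def wz_def algebra_simps)
    show "((\<lambda>r. w r z $ 1) has_real_derivative wr r z $ 1) (at r within {0..1})"
        "((\<lambda>z. w r z $ 3) has_real_derivative wz r z $ 3) (at z within {-pi..pi})"
      if "r \<in> {0..1}" for r z
      by (intro has_vector_derivative_vec_nth w_r w_z that)+
    show "w 1 z $ 1 = 0" for z
      by (simp add: w_def u.tangent v.tangent t)
  qed (use t u.periodic v.periodic
      in \<open>auto intro!: DERIV_diff u.pressure_r v.pressure_r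
          continuous_intros simp: w_def wr_def wz_def\<close>)
  have "continuous_on ?Q (\<lambda>(r, z). r * (w r z \<bullet> w r z))"
    unfolding case_prod_beta w_def by (intro continuous_intros)
  then have 3: "((\<lambda>(r, z). r * (w r z \<bullet> w r z)) has_integral
      integral ?Q (\<lambda>(r, z). r * (w r z \<bullet> w r z))) ?Q"
    by (intro integrable_integral integrable_continuous)
  have "continuous_on ?Q (\<lambda>(r, z). r * (2 * (w r z \<bullet> (ut t r z - vt t r z))))"
    unfolding case_prod_beta w_def by (intro continuous_intros)
  then have 4: "((\<lambda>(r, z). r * (2 * (w r z \<bullet> (ut t r z - vt t r z)))) has_integral
      integral ?Q (\<lambda>(r, z). r * (2 * (w r z \<bullet> (ut t r z - vt t r z))))) ?Q"
    by (intro integrable_integral integrable_continuous)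
  have le: "r * (2 * (w r z \<bullet> (ut t r z - vt t r z)))
      \<le> (- 2) * (r * (u t r z $ 1 * (w r z \<bullet> wr r z) + u t r z $ 3 * (w r z \<bullet> wz r z)))
        + ((- 2) * (r * (w r z $ 1 * (pr t r z - qr t r z) + w r z $ 3 * (pz t r z - qz t r z)))
        + (6 * K) * (r * (w r z \<bullet> w r z)))"
    if "r \<in> {0..1}" "z \<in> {-pi..pi}" for r z
  \<comment> \<open>On the axis, where \<open>momentum\<close> says nothing, the weight makes both
    sides zero. Elsewhere the transport and pressure terms are kept, since they vanish only after
    integration.\<close>
  proof (cases "r = 0")
    case False
    then have r: "0 < r" "r \<le> 1" using that by auto
    let ?w = "w r z"
    define ws where "ws = us t r z - vs t r z"
    define g :: "real ^ 3" where "g = vector [pr t r z, 0, pz t r z] - vector [qr t r z, 0, qz t r z]"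
    have g: "?w \<bullet> g = ?w $ 1 * (pr t r z - qr t r z) + ?w $ 3 * (pz t r z - qz t r z)"
      by (simp add: g_def vec3_inner)
    \<comment> \<open>\<open>r *\<^sub>R ws\<close> is the horizontal part of \<open>?w\<close>
      turned by a right angle, hence orthogonal to \<open>?w\<close>: the angular transport does no
      work.\<close>
    have swirl: "?w \<bullet> ws = 0"
    proof -
      have "r *\<^sub>R ws = vector [- (?w $ 2), ?w $ 1, 0]"
        unfolding ws_def scaleR_diff_right u.swirl[OF t r] v.swirl[OF t r]
        by (simp add: vec_eq_iff forall_3 w_def)
      then have "r * (?w \<bullet> ws) = ?w \<bullet> vector [- (?w $ 2), ?w $ 1, 0]"
        by (metis inner_scaleR_right)
      then show ?thesis using r by (simp add: vec3_inner)
    qed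
    have "ut t r z - vt t r z
      = - ((u t r z $ 1) *\<^sub>R wr r z + (u t r z $ 2) *\<^sub>R ws + (u t r z $ 3) *\<^sub>R wz r z)
        - ((?w $ 1) *\<^sub>R vr t r z + (?w $ 2) *\<^sub>R vs t r z + (?w $ 3) *\<^sub>R vz t r z) - g"
      unfolding eq_diff_eq[THEN iffD2, OF u.momentum[OF t r, of z]]
        eq_diff_eq[THEN iffD2, OF v.momentum[OF t r, of z]]
      by (simp add: w_def wr_def wz_def ws_def g_def algebra_simps)
    then have "?w \<bullet> (ut t r z - vt t r z)
      = - (u t r z $ 1 * (?w \<bullet> wr r z) + u t r z $ 3 * (?w \<bullet> wz r z))
        - (?w $ 1 * (pr t r z - qr t r z) + ?w $ 3 * (pz t r z - qz t r z))
        - ((?w $ 1) * (?w \<bullet> vr t r z) + (?w $ 2) * (?w \<bullet> vs t r z) + (?w $ 3) * (?w \<bullet> vz t r z))"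
      by (simp add: inner_diff_right inner_add_right swirl g)
    moreover have "- (?w $ i * (?w \<bullet> y)) \<le> K * (?w \<bullet> ?w)" if "norm y \<le> K" for y and i :: 3
    proof -
      have "\<bar>?w $ i * (?w \<bullet> y)\<bar> \<le> norm ?w * (norm ?w * norm y)"
        unfolding abs_mult by (intro mult_mono component_le_norm_cart Cauchy_Schwarz_ineq2) auto
      also have "\<dots> \<le> norm ?w * (norm ?w * K)"
        using that by (intro mult_left_mono) auto
      also have "\<dots> = K * (?w \<bullet> ?w)"
        by (simp add: dot_square_norm power2_eq_square)
      finally show ?thesis by linarith
    qed
    then have "- (?w $ 1 * (?w \<bullet> vr t r z)) \<le> K * (?w \<bullet> ?w)"
      "- (?w $ 2 * (?w \<bullet> vs t r z)) \<le> K * (?w \<bullet> ?w)" "- (?w $ 3 * (?w \<bullet> vz t r z)) \<le> K * (?w \<bullet> ?w)"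
      using K[OF that] by auto
    moreover have "2 * X \<le> (- 2) * Y + ((- 2) * Z + (6 * K) * W)"
      if "X = - Y - Z - (R1 + R2 + R3)" "- R1 \<le> K * W" "- R2 \<le> K * W" "- R3 \<le> K * W"
      for X Y Z R1 R2 R3 W :: real
      using that by (simp add: algebra_simps)
    ultimately have "2 * (?w \<bullet> (ut t r z - vt t r z))
      \<le> (- 2) * (u t r z $ 1 * (?w \<bullet> wr r z) + u t r z $ 3 * (?w \<bullet> wz r z))
        + ((- 2) * (?w $ 1 * (pr t r z - qr t r z) + ?w $ 3 * (pz t r z - qz t r z)) + (6 * K) * (?w \<bullet> ?w))"
      by blast
    from mult_left_mono[OF this, of r] r show ?thesis
      by (simp add: algebra_simps)
  qed simp
  have "integral ?Q (\<lambda>(r, z). r * (2 * (w r z \<bullet> (ut t r z - vt t r z))))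
      \<le> (- 2) * 0 + ((- 2) * 0 + (6 * K) * integral ?Q (\<lambda>(r, z). r * (w r z \<bullet> w r z)))"
  proof (intro has_integral_le[OF 4 has_integral_add[OF has_integral_mult_right[OF 1]
          has_integral_add[OF has_integral_mult_right[OF 2] has_integral_mult_right[OF 3]]]])
    fix x assume "x \<in> ?Q"
    moreover obtain r z where "x = (r, z)" by (cases x)
    ultimately show "(case x of (r, z) \<Rightarrow> r * (2 * (w r z \<bullet> (ut t r z - vt t r z))))
      \<le> (- 2) * (case x of (r, z) \<Rightarrow> r * (u t r z $ 1 * (w r z \<bullet> wr r z) + u t r z $ 3 * (w r z \<bullet> wz r z)))
        + ((- 2) * (case x of (r, z) \<Rightarrow>
            r * (w r z $ 1 * (pr t r z - qr t r z) + w r z $ 3 * (pz t r z - qz t r z)))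
        + (6 * K) * (case x of (r, z) \<Rightarrow> r * (w r z \<bullet> w r z)))"
      using le[of r z] by auto
  qed
  then show ?thesis
    by (simp add: w_def)
qed

text \<open>The weighted energy of the difference satisfies a Gronwall inequality with zero initial
  value. It controls the difference off the axis, where the weight is positive.\<close>

lemma axisymmetric_euler_unique:
  assumes "axisymmetric_euler u ut ur us uz p pr pz" and "axisymmetric_euler v vt vr vs vz q qr qz"
    and init: "\<And>r z. 0 < r \<Longrightarrow> r \<le> 1 \<Longrightarrow> z \<in> {-pi..pi} \<Longrightarrow> u 0 r z = v 0 r z"
    and T: "0 \<le> T" and rz: "0 < r" "r \<le> 1" "z \<in> {-pi..pi}"
  shows "u T r z = v T r z"
proof -
  interpret u: axisymmetric_euler u ut ur us uz p pr pz by fact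
  interpret v: axisymmetric_euler v vt vr vs vz q qr qz by fact
  let ?Q = "cbox (0, -pi) (1, pi) :: (real \<times> real) set"
  let ?e = "\<lambda>t (r, z). r * ((u t r z - v t r z) \<bullet> (u t r z - v t r z))"
  let ?e' = "\<lambda>t (r, z). r * (2 * ((u t r z - v t r z) \<bullet> (ut t r z - vt t r z)))"
  define E where "E t = integral ?Q (?e t)" for t
  have cont: "continuous_on ?Q (?e t)" if "0 \<le> t" for t
    unfolding case_prod_beta by (intro continuous_intros u.cont_slice v.cont_slice that)
  obtain K1 where K1: "\<And>t r z. t \<in> {0..T} \<Longrightarrow> r \<in> {0..1} \<Longrightarrow> z \<in> {-pi..pi} \<Longrightarrow> norm (vr t r z) \<le> K1"
    using bounded_on_time_slab[OF v.cont(3)] by blast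
  obtain K2 where K2: "\<And>t r z. t \<in> {0..T} \<Longrightarrow> r \<in> {0..1} \<Longrightarrow> z \<in> {-pi..pi} \<Longrightarrow> norm (vs t r z) \<le> K2"
    using bounded_on_time_slab[OF v.cont(4)] by blast
  obtain K3 where K3: "\<And>t r z. t \<in> {0..T} \<Longrightarrow> r \<in> {0..1} \<Longrightarrow> z \<in> {-pi..pi} \<Longrightarrow> norm (vz t r z) \<le> K3"
    using bounded_on_time_slab[OF v.cont(5)] by blast
  \<comment> \<open>Only the gradient of \<open>v\<close> has to be bounded: \<open>u\<close> merely
    transports the energy of the difference.\<close>
  define K where "K = max K1 (max K2 K3)"
  have E': "(E has_real_derivative integral ?Q (?e' t)) (at t within {0..})" if "0 \<le> t" for t
    unfolding E_def
  proof (rule leibniz_rule_field_derivative)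
    show "((\<lambda>t. ?e t x) has_real_derivative ?e' t x) (at t within {0..})"
      if tx: "t \<in> {0..}" "x \<in> ?Q" for t x
    proof -
      obtain r z where x: "x = (r, z)" and "r \<in> {0..1}"
        using tx by (cases x) auto
      then have "((\<lambda>t. u t r z - v t r z) has_vector_derivative ut t r z - vt t r z) (at t within {0..})"
        using tx by (intro derivative_intros u.deriv_t v.deriv_t) auto
      from DERIV_cmult[OF has_real_derivative_inner_self[OF this], of r] show ?thesis
        by (simp add: x)
    qed
    show "?e t integrable_on ?Q" if "t \<in> {0..}" for t
      using cont that by (intro integrable_continuous) auto
    have "continuous_on ({0..} \<times> ?Q) (\<lambda>(t, r, z). g t r z)"
      if "continuous_on ({0..} \<times> {0..1} \<times> UNIV) (\<lambda>(t, r, z). g t r z)"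
      for g :: "real \<Rightarrow> real \<Rightarrow> real \<Rightarrow> real ^ 3"
      by (rule continuous_on_subset[OF that]) auto
    note [continuous_intros] = this[OF u.cont(1), unfolded case_prod_beta]
      this[OF u.cont(2), unfolded case_prod_beta] this[OF v.cont(1), unfolded case_prod_beta]
      this[OF v.cont(2), unfolded case_prod_beta]
    show "continuous_on ({0..} \<times> ?Q) (\<lambda>(t, x). ?e' t x)"
      unfolding case_prod_beta by (intro continuous_intros)
  qed (use that in auto)
  have "E T \<le> exp (6 * K * T) * E 0"
  proof (rule half_line_gronwall[OF E' _ T])
    show "integral ?Q (?e' t) \<le> 6 * K * E t" if "0 \<le> t" "t \<le> T" for t
    proof -
      have "norm (vr t r z) \<le> K \<and> norm (vs t r z) \<le> K \<and> norm (vz t r z) \<le> K"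
        if "r \<in> {0..1}" "z \<in> {-pi..pi}" for r z
        using K1[of t r z] K2[of t r z] K3[of t r z] that \<open>0 \<le> t\<close> \<open>t \<le> T\<close>
        by (auto simp: K_def le_max_iff_disj)
      from axisymmetric_euler_energy_inequality[OF assms(1,2) \<open>0 \<le> t\<close> this] show ?thesis
        unfolding E_def .
    qed
  qed
  moreover have "E 0 = 0"
  proof -
    have "?e 0 x = 0" if "x \<in> ?Q" for x
      using init that by (cases x, cases "fst x = 0") auto
    then show ?thesis
      unfolding E_def by (intro integral_unique has_integral_is_0_cbox)
  qed
  moreover have nonneg: "0 \<le> ?e T x" if "x \<in> ?Q" for x
    using that by (cases x) auto
  then have "0 \<le> E T"
    unfolding E_def by (intro integral_nonneg integrable_continuous cont T)
  ultimately have "integral ?Q (?e T) = 0"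
    by (simp add: E_def)
  \<comment> \<open>A continuous nonnegative integrand with zero integral vanishes throughout a box
    with nonempty interior; \<open>0 < r\<close> then allows division by the weight.\<close>
  moreover have "box (0, -pi) (1, pi) \<noteq> ({} :: (real \<times> real) set)"
    by (simp add: box_ne_empty Basis_prod_def)
  ultimately have "\<forall>x\<in>?Q. ?e T x = 0"
    using integral_cbox_eq_0_iff[OF cont[OF T] _ nonneg] by blast
  from bspec[OF this, of "(r, z)"] rz show ?thesis
    by auto
qed


subsection \<open>Reflection symmetry and the flow at the boundary circle\<close>

text \<open>The momentum equation yields the radial derivative of \<open>ut\<close>, whereas the
  Riccati system needs the time derivative of \<open>ur\<close>. Writing \<open>f\<close> as its
  initial value plus a time integral of \<open>ft\<close> and differentiating under the integral
  exhibits \<open>fr\<close> as a time primitive of \<open>ftr\<close>. The argument covers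
  \<open>t = 0\<close> and the ends of the radial interval, where derivatives are one-sided.\<close>

lemma mixed_derivative_swap:
  fixes f :: "real \<Rightarrow> real \<Rightarrow> 'a::banach"
  assumes "a < b"
    and ft: "\<And>t r. 0 \<le> t \<Longrightarrow> r \<in> {a..b} \<Longrightarrow>
      ((\<lambda>t. f t r) has_vector_derivative ft t r) (at t within {0..})"
    and fr: "\<And>t r. 0 \<le> t \<Longrightarrow> r \<in> {a..b} \<Longrightarrow>
      ((\<lambda>r. f t r) has_vector_derivative fr t r) (at r within {a..b})"
    and ftr: "\<And>t r. 0 \<le> t \<Longrightarrow> r \<in> {a..b} \<Longrightarrow>
      ((\<lambda>r. ft t r) has_vector_derivative ftr t r) (at r within {a..b})"
    and cont: "continuous_on ({a..b} \<times> {0..}) (\<lambda>(r, t). ftr t r)"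
    and "0 \<le> t" "r \<in> {a..b}"
  shows "((\<lambda>t. fr t r) has_vector_derivative ftr t r) (at t within {0..})"
proof -
  have ftc: "((\<lambda>s. ft s r) has_integral (f t r - f 0 r)) {0..t}" if "0 \<le> t" "r \<in> {a..b}" for t r
    using that by (intro fundamental_theorem_of_calculus has_vector_derivative_within_subset[OF ft]) auto
  have fr_eq: "fr t r = fr 0 r + integral {0..t} (\<lambda>s. ftr s r)" if "0 \<le> t" for t
  proof -
    have "((\<lambda>r. integral (cbox 0 t) (\<lambda>s. ft s r)) has_vector_derivative
        integral (cbox 0 t) (\<lambda>s. ftr s r)) (at r within {a..b})"
    proof (rule leibniz_rule_vector_derivative)
      show "continuous_on ({a..b} \<times> cbox 0 t) (\<lambda>(r, s). ftr s r)"
        by (rule continuous_on_subset[OF cont]) auto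
      show "(\<lambda>s. ft s r) integrable_on cbox 0 t" if "r \<in> {a..b}" for r
        using ftc[OF \<open>0 \<le> t\<close> that] by (auto simp: integrable_on_def)
    qed (use ftr \<open>r \<in> {a..b}\<close> in auto)
    then have "((\<lambda>r. f 0 r + integral {0..t} (\<lambda>s. ft s r)) has_vector_derivative
        fr 0 r + integral {0..t} (\<lambda>s. ftr s r)) (at r within {a..b})"
      using fr[of 0 r] \<open>r \<in> {a..b}\<close> by (auto intro: has_vector_derivative_add)
    then have "((\<lambda>r. f t r) has_vector_derivative
        fr 0 r + integral {0..t} (\<lambda>s. ftr s r)) (at r within {a..b})"
      by (rule has_vector_derivative_transform[rotated 2])
        (use \<open>r \<in> {a..b}\<close> integral_unique[OF ftc[OF that]] in auto)
    from fr[OF that \<open>r \<in> {a..b}\<close>] this show ?thesis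
      using \<open>a < b\<close> \<open>r \<in> {a..b}\<close> by (intro vector_derivative_unique_within_closed_interval[of a b]) auto
  qed
  have "continuous_on {0..} (\<lambda>s. (\<lambda>(r, t). ftr t r) (r, s))"
    using \<open>r \<in> {a..b}\<close> by (intro continuous_on_compose2[OF cont] continuous_intros) auto
  then have "((\<lambda>t. fr 0 r + integral {0..t} (\<lambda>s. ftr s r)) has_vector_derivative 0 + ftr t r)
      (at t within {0..})"
    using \<open>0 \<le> t\<close> by (intro derivative_intros half_line_integral) auto
  then show ?thesis
    unfolding add_0_left
    by (rule has_vector_derivative_transform[rotated 2]) (use \<open>0 \<le> t\<close> in \<open>auto intro: fr_eq\<close>)
qed

definition flip_z :: "real ^ 3 \<Rightarrow> real ^ 3" where
  "flip_z v = vector [v $ 1, v $ 2, - (v $ 3)]"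

lemma flip_z_nth [simp]: "flip_z v $ 1 = v $ 1" "flip_z v $ 2 = v $ 2" "flip_z v $ 3 = - (v $ 3)"
  by (simp_all add: flip_z_def)

lemma bounded_linear_flip_z: "bounded_linear flip_z"
  by (intro linear_conv_bounded_linear[THEN iffD1] linearI) (auto simp: vec_eq_iff forall_3)

lemma flip_z_linear: "flip_z (x + y) = flip_z x + flip_z y" "flip_z (c *\<^sub>R x) = c *\<^sub>R flip_z x"
    "flip_z (- x) = - flip_z x"
  by (simp_all add: vec_eq_iff forall_3)

lemma flip_z_vector: "flip_z (vector [x, y, z]) = vector [x, y, - z]"
  by (simp add: vec_eq_iff forall_3)

context axisymmetric_euler
begin

text \<open>The equations are invariant under the isometry z to -z, and so is the periodicity. The
  minus signs on \<open>uz\<close> and \<open>pz\<close> come from the chain rule.\<close>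

lemma reflection:
  "axisymmetric_euler (\<lambda>t r z. flip_z (u t r (- z))) (\<lambda>t r z. flip_z (ut t r (- z)))
    (\<lambda>t r z. flip_z (ur t r (- z))) (\<lambda>t r z. flip_z (us t r (- z))) (\<lambda>t r z. - flip_z (uz t r (- z)))
    (\<lambda>t r z. p t r (- z)) (\<lambda>t r z. pr t r (- z)) (\<lambda>t r z. - pz t r (- z))"
proof
  have *: "continuous_on ({0..} \<times> {0..1} \<times> UNIV) (\<lambda>(t, r, z). flip_z (g t r (- z)))"
    if "continuous_on ({0..} \<times> {0..1} \<times> UNIV) (\<lambda>(t, r, z). g t r z)"
    for g :: "real \<Rightarrow> real \<Rightarrow> real \<Rightarrow> real ^ 3"
  proof -
    have "continuous_on ({0..} \<times> {0..1} \<times> UNIV) (\<lambda>x. (\<lambda>(t, r, z). g t r z) (fst x, fst (snd x), - snd (snd x)))"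
      by (intro continuous_on_compose2[OF that] continuous_intros) auto
    then show ?thesis
      by (auto simp: case_prod_beta' intro!: bounded_linear.continuous_on[OF bounded_linear_flip_z])
  qed
  show "continuous_on ({0..} \<times> {0..1} \<times> UNIV) (\<lambda>(t, r, z). flip_z (u t r (- z)))"
    "continuous_on ({0..} \<times> {0..1} \<times> UNIV) (\<lambda>(t, r, z). flip_z (ut t r (- z)))"
    "continuous_on ({0..} \<times> {0..1} \<times> UNIV) (\<lambda>(t, r, z). flip_z (ur t r (- z)))"
    "continuous_on ({0..} \<times> {0..1} \<times> UNIV) (\<lambda>(t, r, z). flip_z (us t r (- z)))"
    "continuous_on ({0..} \<times> {0..1} \<times> UNIV) (\<lambda>(t, r, z). - flip_z (uz t r (- z)))"
    using cont[THEN *] by (auto simp: case_prod_beta' intro!: continuous_intros)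
  have *: "continuous_on ({0..1} \<times> UNIV) (\<lambda>(r, z). g r (- z))"
    if "continuous_on ({0..1} \<times> UNIV) (\<lambda>(r, z). g r z)" for g :: "real \<Rightarrow> real \<Rightarrow> real"
  proof -
    have "continuous_on ({0..1} \<times> UNIV) (\<lambda>x. (\<lambda>(r, z). g r z) (fst x, - snd x))"
      by (intro continuous_on_compose2[OF that] continuous_intros) auto
    then show ?thesis
      by (simp add: case_prod_beta')
  qed
  show "continuous_on ({0..1} \<times> UNIV) (\<lambda>(r, z). p t r (- z))"
    "continuous_on ({0..1} \<times> UNIV) (\<lambda>(r, z). pr t r (- z))"
    "continuous_on ({0..1} \<times> UNIV) (\<lambda>(r, z). - pz t r (- z))" if "0 \<le> t" for t
    using cont_pressure[OF that, THEN *] by (auto simp: case_prod_beta' intro!: continuous_intros)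
  fix t r z :: real
  assume t: "0 \<le> t"
  show "flip_z (u t 1 (- z)) $ 1 = 0"
    by (simp add: tangent t)
  { assume r: "0 < r" "r \<le> 1"
    show "r *\<^sub>R flip_z (us t r (- z))
        = vector [- (flip_z (u t r (- z)) $ 2), flip_z (u t r (- z)) $ 1, 0]"
      using arg_cong[OF swirl[OF t r, of "- z"], of flip_z] by (simp add: flip_z_vector flip_z_linear)
    show "flip_z (ut t r (- z)) + ((flip_z (u t r (- z)) $ 1) *\<^sub>R flip_z (ur t r (- z))
        + (flip_z (u t r (- z)) $ 2) *\<^sub>R flip_z (us t r (- z))
        + (flip_z (u t r (- z)) $ 3) *\<^sub>R - flip_z (uz t r (- z)))
      = - vector [pr t r (- z), 0, - pz t r (- z)]"
      using arg_cong[OF momentum[OF t r, of "- z"], of flip_z]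
      by (simp add: flip_z_vector flip_z_linear) }
  assume r: "r \<in> {0..1}"
  show "((\<lambda>t. flip_z (u t r (- z))) has_vector_derivative flip_z (ut t r (- z))) (at t within {0..})"
    by (intro bounded_linear.has_vector_derivative[OF bounded_linear_flip_z] deriv_t t r)
  show "((\<lambda>r. flip_z (u t r (- z))) has_vector_derivative flip_z (ur t r (- z))) (at r within {0..1})"
    by (intro bounded_linear.has_vector_derivative[OF bounded_linear_flip_z] deriv_r t r)
  have "((u t r \<circ> uminus) has_vector_derivative (- 1) *\<^sub>R uz t r (- z)) (at z)"
    by (rule vector_diff_chain_at) (auto intro!: derivative_eq_intros deriv_z t r)
  from bounded_linear.has_vector_derivative[OF bounded_linear_flip_z, OF this]
  show "((\<lambda>z. flip_z (u t r (- z))) has_vector_derivative - flip_z (uz t r (- z))) (at z)"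
    by (simp add: o_def flip_z_linear)
  show "((\<lambda>r. p t r (- z)) has_real_derivative pr t r (- z)) (at r within {0..1})"
    by (intro pressure_r t r)
  show "((\<lambda>z. p t r (- z)) has_real_derivative - pz t r (- z)) (at z)"
    using DERIV_chain2[OF pressure_z[OF t r, of "- z"] DERIV_minus[OF DERIV_ident]] by simp
  show "flip_z (ur t r (- z)) $ 1 + flip_z (us t r (- z)) $ 2 + (- flip_z (uz t r (- z))) $ 3 = 0"
    using incompressible[OF t r, of "- z"] by simp
  show "flip_z (u t r (- (- pi))) = flip_z (u t r (- pi))" "p t r (- (- pi)) = p t r (- pi)"
    using periodic[OF t r] by auto
qed

lemma vertical_velocity_zero:
  assumes "\<And>r z. 0 < r \<Longrightarrow> r \<le> 1 \<Longrightarrow> z \<in> {-pi..pi} \<Longrightarrow> u 0 r (- z) = flip_z (u 0 r z)"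
    and "0 \<le> t" "0 < r" "r \<le> 1"
  shows "u t r 0 $ 3 = 0"
proof -
  have "u t r 0 = flip_z (u t r (- 0))"
    by (rule axisymmetric_euler_unique[OF axisymmetric_euler_axioms reflection])
      (use assms in \<open>auto simp: vec_eq_iff forall_3\<close>)
  from arg_cong[OF this, of "\<lambda>v. v $ 3"] show ?thesis by simp
qed

end

section \<open>Radial derivatives on the boundary circle\<close>

lemma not_bot_at_boundary: "at (r::real) within {0<..1} \<noteq> bot" if "0 < r" "r \<le> 1"
proof -
  have "r islimpt {0<..<r}"
    using that by (intro islimpt_greaterThanLessThan2) auto
  then have "r islimpt {0<..1}"
    by (rule islimpt_subset) (use that in auto)
  then show ?thesis
    by (simp add: trivial_limit_within)
qed

lemma d_r_eq:
  assumes "((\<lambda>s. f s z) has_real_derivative D) (at r within {0<..1})" "0 < r" "r \<le> 1"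
  shows "d_r f r z = D"
  using assms not_bot_at_boundary
  by (auto simp: d_r_def has_real_derivative_iff_has_vector_derivative intro!: vector_derivative_within)

text \<open>The two functions have the same derivatives within \<open>{0<..1}\<close>, so the choice
  inside \<open>vector_derivative\<close> agrees even where no derivative exists. This lets
  \<open>d_r\<close> be iterated on the pressure.\<close>

lemma d_r_cong:
  assumes "\<And>s. 0 < s \<Longrightarrow> s \<le> 1 \<Longrightarrow> f s z = g s z" "0 < r" "r \<le> 1"
  shows "d_r f r z = d_r g r z"
proof -
  have "((\<lambda>s. f s z) has_vector_derivative D) (at r within {0<..1})
      \<longleftrightarrow> ((\<lambda>s. g s z) has_vector_derivative D) (at r within {0<..1})" for D
    using assms
      has_vector_derivative_transform[of r "{0<..1}" "\<lambda>s. f s z" "\<lambda>s. g s z" D]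
      has_vector_derivative_transform[of r "{0<..1}" "\<lambda>s. g s z" "\<lambda>s. f s z" D]
    by auto
  then show ?thesis
    by (simp add: d_r_def vector_derivative_def)
qed

context axisymmetric_euler
begin

text \<open>All terms of the angular momentum equation except \<open>ut\<close> vanish on the
  circle: the radial velocity by tangency, the vertical one by \<open>sym\<close>, and
  \<open>us t 1 0 $ 2\<close> because it equals the radial velocity there. The pressure gradient has
  no angular component.\<close>

lemma boundary_stagnation:
  assumes sym: "\<And>t. 0 \<le> t \<Longrightarrow> u t 1 0 $ 3 = 0" and t: "0 \<le> t"
  shows "u t 1 0 $ 2 = u 0 1 0 $ 2"
proof (rule half_line_constant[OF _ t])
  fix s :: real assume s: "0 \<le> s"
  have "us s 1 0 $ 2 = 0"
    using arg_cong[OF swirl[OF s, of 1 0], of "\<lambda>v. v $ 2"] tangent[OF s] by simp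
  then have "ut s 1 0 $ 2 = 0"
    using arg_cong[OF momentum[OF s, of 1 0], of "\<lambda>v. v $ 2"] tangent[OF s] sym[OF s] by simp
  then show "((\<lambda>t. u t 1 0 $ 2) has_real_derivative 0) (at s within {0..})"
    using has_vector_derivative_vec_nth[OF deriv_t[OF s, of 1 0], of 2] by simp
qed

text \<open>
  Obtained by differentiating the momentum equation in \<open>r\<close> along \<open>z = 0\<close>, where its \<open>uz\<close> terms vanish.
\<close>

lemma boundary_derivatives:
  assumes sym: "\<And>r. 0 < r \<Longrightarrow> r \<le> 1 \<Longrightarrow> u t r 0 $ 3 = 0"
    and urr: "((\<lambda>r. ur t r 0) has_vector_derivative urr) (at 1 within {0..1})"
    and utr: "((\<lambda>r. ut t r 0) has_vector_derivative utr) (at 1 within {0..1})"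
    and t: "0 \<le> t"
  defines "b \<equiv> u t 1 0 $ 2"
  shows "d_r (d_r (p t)) 1 0 = - utr $ 1 - (ur t 1 0 $ 1)\<^sup>2 + 2 * b * ur t 1 0 $ 2 - b\<^sup>2"
    and "utr $ 2 = - ur t 1 0 $ 1 * (ur t 1 0 $ 2 + b)"
proof -
  have eqs: "pr t r 0 = - (ut t r 0 $ 1) - u t r 0 $ 1 * ur t r 0 $ 1 + (u t r 0 $ 2)\<^sup>2 / r"
      "ut t r 0 $ 2 = - (u t r 0 $ 1) * ur t r 0 $ 2 - u t r 0 $ 1 * u t r 0 $ 2 / r"
    if r: "0 < r" "r \<le> 1" for r
  proof -
    have "us t r 0 $ 1 = - (u t r 0 $ 2) / r" "us t r 0 $ 2 = u t r 0 $ 1 / r"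
      using arg_cong[OF swirl[OF t r, of 0], of "\<lambda>v. v $ 1"]
        arg_cong[OF swirl[OF t r, of 0], of "\<lambda>v. v $ 2"] r
      by (simp_all add: field_simps)
    then show "pr t r 0 = - (ut t r 0 $ 1) - u t r 0 $ 1 * ur t r 0 $ 1 + (u t r 0 $ 2)\<^sup>2 / r"
        "ut t r 0 $ 2 = - (u t r 0 $ 1) * ur t r 0 $ 2 - u t r 0 $ 1 * u t r 0 $ 2 / r"
      using arg_cong[OF momentum[OF t r, of 0], of "\<lambda>v. v $ 1"]
        arg_cong[OF momentum[OF t r, of 0], of "\<lambda>v. v $ 2"] sym[OF r]
      by (simp_all add: power2_eq_square algebra_simps)
  qed
  \<comment> \<open>\<open>d_r\<close> differentiates within \<open>{0<..1}\<close>, while the flow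
    is differentiable within \<open>{0..1}\<close>.\<close>
  have sub: "{0<..1} \<subseteq> {0..1::real}" by auto
  note urr' = has_vector_derivative_vec_nth[OF has_vector_derivative_within_subset[OF urr sub]]
  note utr' = has_vector_derivative_vec_nth[OF has_vector_derivative_within_subset[OF utr sub]]
  have ur': "((\<lambda>r. u t r 0 $ i) has_real_derivative ur t 1 0 $ i) (at 1 within {0<..1})" for i
    by (rule has_vector_derivative_vec_nth[OF has_vector_derivative_within_subset[OF deriv_r[OF t] sub]]) simp
  have u0: "u t 1 0 $ 1 = 0" by (rule tangent[OF t])
  have dp: "d_r (p t) r 0 = - (ut t r 0 $ 1) - u t r 0 $ 1 * ur t r 0 $ 1 + (u t r 0 $ 2)\<^sup>2 / r"
    if r: "0 < r" "r \<le> 1" for r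
  proof -
    have "((\<lambda>r. p t r 0) has_real_derivative pr t r 0) (at r within {0<..1})"
      by (rule has_field_derivative_subset[OF pressure_r[OF t] sub]) (use r in auto)
    from d_r_eq[where f = "p t" and z = 0, OF this r] show ?thesis
      using eqs(1)[OF r] by simp
  qed
  \<comment> \<open>The second derivative \<open>urr\<close> enters with the factor
    \<open>u t 1 0 $ 1 = 0\<close>, so apart from \<open>utr\<close> only first derivatives of the
    velocity survive.\<close>
  have "((\<lambda>r. - (ut t r 0 $ 1) - u t r 0 $ 1 * ur t r 0 $ 1 + (u t r 0 $ 2)\<^sup>2 / r) has_real_derivative
      - utr $ 1 - (ur t 1 0 $ 1)\<^sup>2 + 2 * b * ur t 1 0 $ 2 - b\<^sup>2) (at 1 within {0<..1})"
    by (rule derivative_eq_intros utr' ur' urr' refl | simp add: u0 b_def power2_eq_square algebra_simps)+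
  then have "((\<lambda>r. d_r (p t) r 0) has_real_derivative
      - utr $ 1 - (ur t 1 0 $ 1)\<^sup>2 + 2 * b * ur t 1 0 $ 2 - b\<^sup>2) (at 1 within {0<..1})"
    unfolding has_real_derivative_iff_has_vector_derivative
    by (rule has_vector_derivative_transform[rotated 2]) (use dp in auto)
  then show "d_r (d_r (p t)) 1 0 = - utr $ 1 - (ur t 1 0 $ 1)\<^sup>2 + 2 * b * ur t 1 0 $ 2 - b\<^sup>2"
    by (rule d_r_eq) auto
  have "((\<lambda>r. - (u t r 0 $ 1) * ur t r 0 $ 2 - u t r 0 $ 1 * u t r 0 $ 2 / r) has_real_derivative
      - ur t 1 0 $ 1 * (ur t 1 0 $ 2 + b)) (at 1 within {0<..1})"
    by (rule derivative_eq_intros ur' urr' refl | simp add: u0 b_def power2_eq_square algebra_simps)+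
  then have "((\<lambda>r. ut t r 0 $ 2) has_real_derivative - ur t 1 0 $ 1 * (ur t 1 0 $ 2 + b)) (at 1 within {0<..1})"
    unfolding has_real_derivative_iff_has_vector_derivative
    by (rule has_vector_derivative_transform[rotated 2]) (use eqs in auto)
  with utr'[of 2] show "utr $ 2 = - ur t 1 0 $ 1 * (ur t 1 0 $ 2 + b)"
    using vector_derivative_unique_within[OF not_bot_at_boundary[of 1]]
    by (simp add: has_real_derivative_iff_has_vector_derivative)
qed

text \<open>The traces \<open>A\<close> and \<open>g\<close> at the circle satisfy the Riccati
  system. Continuity of \<open>utr\<close> is what turns it from the radial derivative of
  \<open>ut\<close> into the time derivative of \<open>ur\<close>.\<close>

lemma no_global_flow:
  assumes even: "\<And>r z. 0 < r \<Longrightarrow> r \<le> 1 \<Longrightarrow> z \<in> {-pi..pi} \<Longrightarrow> u 0 r (- z) = flip_z (u 0 r z)"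
    and urr: "\<And>t r. 0 \<le> t \<Longrightarrow> r \<in> {0..1} \<Longrightarrow>
      ((\<lambda>r. ur t r 0) has_vector_derivative urr t r) (at r within {0..1})"
    and utr: "\<And>t r. 0 \<le> t \<Longrightarrow> r \<in> {0..1} \<Longrightarrow>
      ((\<lambda>r. ut t r 0) has_vector_derivative utr t r) (at r within {0..1})"
    and cont_utr: "continuous_on ({0..1} \<times> {0..}) (\<lambda>(r, t). utr t r)"
  defines "b \<equiv> u 0 1 0 $ 2" and "b' \<equiv> ur 0 1 0 $ 2" and "a' \<equiv> ur 0 1 0 $ 1"
  assumes neg: "2 * b * (b + b') < 0" "a' < 0"
  shows "\<not> (\<forall>t\<ge>0. 0 \<le> d_r (d_r (p t)) 1 0 + 3 * b\<^sup>2)"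
    and "0 < k \<Longrightarrow> k * (k + a') < - (2 * b * (b + b')) \<Longrightarrow>
      \<not> (\<forall>t\<ge>0. - k\<^sup>2 \<le> d_r (d_r (p t)) 1 0 + 3 * b\<^sup>2)"
proof -
  have w0: "u t r 0 $ 3 = 0" if "0 \<le> t" "0 < r" "r \<le> 1" for t r
    by (rule vertical_velocity_zero[OF even that])
  have b: "u t 1 0 $ 2 = b" if "0 \<le> t" for t
    unfolding b_def by (rule boundary_stagnation[OF _ that]) (simp add: w0)
  have swap: "((\<lambda>t. ur t 1 0) has_vector_derivative utr t 1) (at t within {0..})" if "0 \<le> t" for t
    using that by (intro mixed_derivative_swap[OF zero_less_one deriv_t deriv_r utr cont_utr]) auto
  define A where "A t = ur t 1 0 $ 1" for t
  define g where "g t = 2 * b * (b + ur t 1 0 $ 2)" for t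
  \<comment> \<open>With \<open>b'\<close> the radial derivative of the swirl,
    \<open>2 * b * b' - b\<^sup>2\<close> equals \<open>g - 3 * b\<^sup>2\<close>; this is the
    origin of the shift of the pressure term.\<close>
  define q where "q t = d_r (d_r (p t)) 1 0 + 3 * b\<^sup>2" for t
  have A: "(A has_real_derivative g t - q t - (A t)\<^sup>2) (at t within {0..})" if "0 \<le> t" for t
  proof -
    have "utr t 1 $ 1 = g t - q t - (A t)\<^sup>2"
      using boundary_derivatives(1)[OF w0 urr utr, OF that] that
      by (simp add: b A_def g_def q_def power2_eq_square algebra_simps)
    with has_vector_derivative_vec_nth[OF swap[OF that], of 1] show ?thesis
      by (simp add: A_def[abs_def])
  qed
  have g: "(g has_real_derivative - A t * g t) (at t within {0..})" if "0 \<le> t" for t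
  proof -
    have "utr t 1 $ 2 = - A t * (ur t 1 0 $ 2 + b)"
      using boundary_derivatives(2)[OF w0 urr utr, OF that] that by (simp add: b A_def)
    with has_vector_derivative_vec_nth[OF swap[OF that], of 2] show ?thesis
      unfolding g_def[abs_def] by (auto intro!: derivative_eq_intros simp: algebra_simps)
  qed
  have ini: "g 0 = 2 * b * (b + b')" "A 0 = a'"
    by (simp_all add: g_def A_def b'_def a'_def)
  show "\<not> (\<forall>t\<ge>0. 0 \<le> d_r (d_r (p t)) 1 0 + 3 * b\<^sup>2)"
    using no_global_riccati_nonneg[OF A g] neg unfolding ini by (auto simp: q_def)
  show "\<not> (\<forall>t\<ge>0. - k\<^sup>2 \<le> d_r (d_r (p t)) 1 0 + 3 * b\<^sup>2)"
    if "0 < k" "k * (k + a') < - (2 * b * (b + b'))"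
    using no_global_riccati_bounded_below[OF A g that(1)] that(2) unfolding ini by (auto simp: q_def)
qed

end


subsection \<open>Reduction of the Euler equation to the meridian half plane\<close>

lemma convex_cylinder: "convex cylinder"
proof -
  have "linear (\<lambda>x::real ^ 3. (x $ 1, x $ 2))"
    by (intro linearI) auto
  from convex_linear_vimage[OF this, of "cball 0 1"]
  have "convex ((\<lambda>x::real ^ 3. (x $ 1, x $ 2)) -` cball 0 1)"
    by simp
  moreover have "cylinder = (\<lambda>x. (x $ 1, x $ 2)) -` cball 0 1"
    by (auto simp: cylinder_def norm_Pair)
  ultimately show ?thesis
    by simp
qed

lemma interior_cylinder: "interior cylinder \<noteq> {}"
proof -
  have "open {x::real ^ 3. (x $ 1)\<^sup>2 + (x $ 2)\<^sup>2 < 1}"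
    by (intro open_Collect_less continuous_intros)
  then have "{x. (x $ 1)\<^sup>2 + (x $ 2)\<^sup>2 < 1} \<subseteq> interior cylinder"
    by (intro interior_maximal) (auto simp: cylinder_def)
  moreover have "0 \<in> {x::real ^ 3. (x $ 1)\<^sup>2 + (x $ 2)\<^sup>2 < 1}" by simp
  ultimately show ?thesis by blast
qed

lemmas has_derivative_unique_cylinder =
  has_derivative_unique_convex[OF convex_cylinder interior_cylinder]

lemma frechet_derivative_cylinder:
  assumes "(f has_derivative L) (at x within cylinder)" "x \<in> cylinder"
  shows "frechet_derivative f (at x within cylinder) = L"
proof -
  have "(f has_derivative frechet_derivative f (at x within cylinder)) (at x within cylinder)"
    using assms(1) differentiableI frechet_derivative_works by blast
  from has_derivative_unique_cylinder[OF assms(2) this assms(1)] show ?thesis .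
qed

lemma cyl_in_cylinder: "r \<in> {-1..1} \<Longrightarrow> cyl r \<theta> z \<in> cylinder"
proof -
  assume "r \<in> {-1..1}"
  have "(r * cos \<theta>)\<^sup>2 + (r * sin \<theta>)\<^sup>2 = r\<^sup>2"
    by (simp add: power_mult_distrib flip: distrib_left)
  then show "cyl r \<theta> z \<in> cylinder"
    using \<open>r \<in> {-1..1}\<close> by (simp add: cylinder_def cyl_def abs_square_le_1 abs_le_iff)
qed

text \<open>This is \<open>cyl r 0 z\<close> as a combination of basis vectors, so that its partial
  derivatives are basis vectors.\<close>

definition mer :: "real \<Rightarrow> real \<Rightarrow> real ^ 3" where
  "mer r z = r *\<^sub>R axis 1 1 + z *\<^sub>R axis 3 1"

lemma mer_eq_cyl: "mer r z = cyl r 0 z"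
  by (simp add: mer_def cyl_def vec_eq_iff forall_3 axis_def)

lemma continuous_on_mer [continuous_intros]:
  "continuous_on S f \<Longrightarrow> continuous_on S g \<Longrightarrow> continuous_on S (\<lambda>x. mer (f x) (g x))"
  unfolding mer_def by (intro continuous_intros)

lemma mer_in_cylinder: "r \<in> {0..1} \<Longrightarrow> mer r z \<in> cylinder"
  unfolding mer_eq_cyl by (rule cyl_in_cylinder) auto

section \<open>Derivatives along rotated circles and coordinate lines\<close>

lemma has_vector_derivative_along_path:
  assumes "(f has_derivative L) (at (\<gamma> s) within S)" "(\<gamma> has_vector_derivative v) (at s within I)"
    and "\<gamma> ` I \<subseteq> S"
  shows "((\<lambda>s. f (\<gamma> s)) has_vector_derivative L v) (at s within I)"
  using vector_derivative_diff_chain_within[OF assms(2) has_derivative_subset[OF assms(1,3)]]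
  by (simp add: o_def)

lemma cyl_deriv_\<theta>:
  "((\<lambda>\<theta>. cyl r \<theta> z) has_vector_derivative r *\<^sub>R axis 2 1) (at 0)"
proof -
  have "((\<lambda>\<theta>. (r * cos \<theta>) *\<^sub>R axis 1 1 + (r * sin \<theta>) *\<^sub>R axis 2 1 + z *\<^sub>R axis 3 1 :: real ^ 3)
      has_vector_derivative r *\<^sub>R axis 2 1) (at 0)"
    by (auto intro!: derivative_eq_intros)
  moreover have "(\<lambda>\<theta>. (r * cos \<theta>) *\<^sub>R axis 1 1 + (r * sin \<theta>) *\<^sub>R axis 2 1 + z *\<^sub>R axis 3 1) = (\<lambda>\<theta>. cyl r \<theta> z)"
    by (auto simp: fun_eq_iff cyl_def vec_eq_iff forall_3 axis_def)
  ultimately show ?thesis by simp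
qed

text \<open>The circle through \<open>mer r z\<close> has velocity
  \<open>r *\<^sub>R axis 2 1\<close>. Along it \<open>a\<close>, \<open>b\<close>, \<open>c\<close>
  are constant and only the frame rotates, so the derivative is found without differentiating the
  components. This supplies \<open>swirl\<close>.\<close>

lemma axisymmetric_field_deriv_\<theta>:
  assumes V: "axisymmetric_field V a b c" and r: "0 < r" "r \<le> 1"
    and L: "(V has_derivative L) (at (mer r z) within cylinder)"
  shows "r *\<^sub>R L (axis 2 1) = vector [- (V (mer r z) $ 2), V (mer r z) $ 1, 0]"
proof -
  interpret L: bounded_linear L by (rule has_derivative_bounded_linear[OF L])
  have 1: "((\<lambda>\<theta>. V (cyl r \<theta> z)) has_vector_derivative L (r *\<^sub>R axis 2 1)) (at 0)"
    by (rule has_vector_derivative_along_path[OF _ cyl_deriv_\<theta>])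
      (use L r in \<open>auto simp: mer_eq_cyl intro!: cyl_in_cylinder\<close>)
  have 2: "(\<lambda>\<theta>. V (cyl r \<theta> z)) = (\<lambda>\<theta>. (a r z * cos \<theta> - b r z * sin \<theta>) *\<^sub>R axis 1 1
      + (a r z * sin \<theta> + b r z * cos \<theta>) *\<^sub>R axis 2 1 + c r z *\<^sub>R axis 3 1)"
    using V r by (auto simp: fun_eq_iff axisymmetric_field_def e_r_def e_\<theta>_def e_z_def vec_eq_iff
        forall_3 axis_def)
  have 3: "((\<lambda>\<theta>. (a r z * cos \<theta> - b r z * sin \<theta>) *\<^sub>R axis 1 1
      + (a r z * sin \<theta> + b r z * cos \<theta>) *\<^sub>R axis 2 1 + c r z *\<^sub>R axis 3 1 :: real ^ 3)
      has_vector_derivative (- b r z) *\<^sub>R axis 1 1 + a r z *\<^sub>R axis 2 1) (at 0)"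
    by (auto intro!: derivative_eq_intros)
  have "L (r *\<^sub>R axis 2 1) = (- b r z) *\<^sub>R axis 1 1 + a r z *\<^sub>R axis 2 1"
    by (rule vector_derivative_unique_at[OF 1]) (simp only: 2 3)
  moreover have "V (mer r z) = vector [a r z, b r z, c r z]"
    using V r by (auto simp: mer_eq_cyl axisymmetric_field_def e_r_def e_\<theta>_def e_z_def vec_eq_iff forall_3)
  ultimately show ?thesis
    by (simp add: L.scaleR vec_eq_iff forall_3 axis_def)
qed

lemma axisymmetric_function_deriv_\<theta>:
  assumes f: "axisymmetric_function f p" and r: "0 < r" "r \<le> 1"
    and L: "(f has_derivative L) (at (mer r z) within cylinder)"
  shows "L (axis 2 1) = 0"
proof -
  interpret L: bounded_linear L by (rule has_derivative_bounded_linear[OF L])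
  have 1: "((\<lambda>\<theta>. f (cyl r \<theta> z)) has_vector_derivative L (r *\<^sub>R axis 2 1)) (at 0)"
    by (rule has_vector_derivative_along_path[OF _ cyl_deriv_\<theta>])
      (use L r in \<open>auto simp: mer_eq_cyl intro!: cyl_in_cylinder\<close>)
  have 2: "(\<lambda>\<theta>. f (cyl r \<theta> z)) = (\<lambda>\<theta>. p r z)"
    using f r by (auto simp: axisymmetric_function_def)
  have "L (r *\<^sub>R axis 2 1) = 0"
    by (rule vector_derivative_unique_at[OF 1]) (simp only: 2 has_vector_derivative_const)
  then show ?thesis using r by (simp add: L.scaleR)
qed

lemma Basis_vec3: "(Basis :: (real ^ 3) set) = {axis 1 1, axis 2 1, axis 3 1}"
proof -
  have "(Basis :: (real ^ 3) set) = range (\<lambda>i. axis i 1)"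
    by (auto simp: Basis_vec_def)
  then show ?thesis by (simp add: UNIV_3)
qed

lemma sum_Basis_vec3: "(\<Sum>i\<in>Basis. f i) = f (axis 1 1) + f (axis 2 1) + f (axis 3 (1::real) :: real ^ 3)"
  by (simp add: Basis_vec3 axis_eq_axis add.assoc)

lemma linear_vec3:
  assumes "linear L"
  shows "L v = (v $ 1) *\<^sub>R L (axis 1 1) + (v $ 2) *\<^sub>R L (axis 2 1) + (v $ 3) *\<^sub>R L (axis 3 (1::real) :: real ^ 3)"
proof -
  have "v = (v $ 1) *\<^sub>R axis 1 1 + (v $ 2) *\<^sub>R axis 2 1 + (v $ 3) *\<^sub>R axis 3 1"
    by (simp add: vec_eq_iff forall_3 axis_def)
  then have "L v = L ((v $ 1) *\<^sub>R axis 1 1 + (v $ 2) *\<^sub>R axis 2 1 + (v $ 3) *\<^sub>R axis 3 1)"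
    by simp
  then show ?thesis
    by (simp only: linear_add[OF assms] linear_scale[OF assms])
qed

lemma grad_vec3:
  assumes "(f has_derivative L) (at x within cylinder)" "x \<in> cylinder"
  shows "grad cylinder f x = vector [L (axis 1 1), L (axis 2 1), L (axis 3 1)]"
  by (simp add: grad_def frechet_derivative_cylinder[OF assms] sum_Basis_vec3 vec_eq_iff forall_3 axis_def)

lemma divergence_vec3:
  assumes "(V has_derivative L) (at x within cylinder)" "x \<in> cylinder"
  shows "divergence cylinder V x = L (axis 1 1) $ 1 + L (axis 2 1) $ 2 + L (axis 3 1) $ 3"
  by (simp add: divergence_def jacobian_def linear_trace_def frechet_derivative_cylinder[OF assms]
      sum_Basis_vec3 inner_axis)

lemma has_vector_derivative_mer:
  "((\<lambda>r. mer r z) has_vector_derivative axis 1 1) (at r within R)"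
  "((\<lambda>z. mer r z) has_vector_derivative axis 3 1) (at z within Z)"
  unfolding mer_def by (auto intro!: derivative_eq_intros)

text \<open>All coefficient functions are directional derivatives of \<open>U\<close> in space-time
  and of \<open>P\<close> in space, restricted to the half plane. Thus continuity up to the axis and
  the boundary is inherited from smoothness in Cartesian coordinates.\<close>

lemma smooth_euler_solution_axisymmetric:
  assumes sol: "smooth_euler_solution \<infinity> U\<^sub>0 U P"
    and field: "\<forall>t\<in>time_interval \<infinity>. axisymmetric_field (U t) (a t) (b t) (c t)"
    and pressure: "\<forall>t\<in>time_interval \<infinity>. axisymmetric_function (P t) (p t)"
  obtains ut ur us uz pr pz urr utr where
    "axisymmetric_euler (\<lambda>t r z. U t (mer r z)) ut ur us uz (\<lambda>t r z. P t (mer r z)) pr pz"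
    "\<And>t r. 0 \<le> t \<Longrightarrow> r \<in> {0..1} \<Longrightarrow>
      ((\<lambda>r. ur t r 0) has_vector_derivative urr t r) (at r within {0..1})"
    "\<And>t r. 0 \<le> t \<Longrightarrow> r \<in> {0..1} \<Longrightarrow>
      ((\<lambda>r. ut t r 0) has_vector_derivative utr t r) (at r within {0..1})"
    "continuous_on ({0..1} \<times> {0..}) (\<lambda>(r, t). utr t r)"
proof -
  have I: "time_interval \<infinity> = {0..}" by (auto simp: time_interval_def)
  let ?S = "{0..} \<times> cylinder"
  let ?G = "\<lambda>(t, x). U t x"
  \<comment> \<open>One order serves the equations themselves, the second the radial derivatives of
    \<open>ur\<close> and \<open>ut\<close>.\<close>
  have "C_k_on (Suc (Suc 0)) ?S ?G"
    using sol by (simp add: smooth_euler_solution_def smooth_on_def I)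
  then obtain D where D: "\<And>x. x \<in> ?S \<Longrightarrow> (?G has_derivative D x) (at x within ?S)"
    and D': "\<And>v. C_k_on (Suc 0) ?S (\<lambda>x. D x v)"
    unfolding C_k_on.simps(2)[of "Suc 0"] by blast
  have "\<exists>H. (\<forall>x\<in>?S. ((\<lambda>x. D x v) has_derivative H x) (at x within ?S)) \<and>
      (\<forall>w. continuous_on ?S (\<lambda>x. H x w))" for v
    using D'[of v] by simp
  then obtain H where H: "\<And>v x. x \<in> ?S \<Longrightarrow> ((\<lambda>x. D x v) has_derivative H v x) (at x within ?S)"
    and contH: "\<And>v w. continuous_on ?S (\<lambda>x. H v x w)"
    by metis
  have contD: "continuous_on ?S (\<lambda>x. D x v)" for v
    by (rule has_derivative_continuous_on[OF H])
  have contG: "continuous_on ?S ?G"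
    by (rule has_derivative_continuous_on[OF D])
  have P: "smooth_on cylinder (P t)" if "0 \<le> t" for t
    using sol that by (auto simp: smooth_euler_solution_def I)
  \<comment> \<open>The pressure is smooth in space at each fixed time, so its derivative is chosen
    time by time; the guard makes the choice total in \<open>t\<close>.\<close>
  have "\<exists>Q. 0 \<le> t \<longrightarrow> (\<forall>x\<in>cylinder. (P t has_derivative Q x) (at x within cylinder)) \<and>
      (\<forall>v. continuous_on cylinder (\<lambda>x. Q x v))" for t
  proof (cases "0 \<le> t")
    case True
    have "C_k_on (Suc 0) cylinder (P t)"
      using P[OF True] by (simp only: smooth_on_def)
    then show ?thesis by simp
  qed simp
  then obtain Q where Q: "\<And>t x. 0 \<le> t \<Longrightarrow> x \<in> cylinder \<Longrightarrow> (P t has_derivative Q t x) (at x within cylinder)"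
    and contQ: "\<And>t v. 0 \<le> t \<Longrightarrow> continuous_on cylinder (\<lambda>x. Q t x v)"
    by metis
  have contP: "continuous_on cylinder (P t)" if "0 \<le> t" for t
    by (rule has_derivative_continuous_on[OF Q[OF that]])
  note mer = mer_in_cylinder
  have slice: "(U t has_derivative (\<lambda>v. D (t, x) (0, v))) (at x within cylinder)"
    if "0 \<le> t" "x \<in> cylinder" for t x
  proof -
    have "((\<lambda>x. ?G (t, x)) has_derivative (\<lambda>v. D (t, x) (0, v))) (at x within cylinder)"
      by (rule has_derivative_in_compose2[where t = ?S and g = ?G and f = "\<lambda>x. (t, x)"])
        (use D that in \<open>auto intro!: derivative_eq_intros\<close>)
    then show ?thesis by simp
  qed
  define e :: "3 \<Rightarrow> real \<times> (real ^ 3)" where "e i = (0, axis i 1)" for i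
  have cont_mer: "continuous_on ({0..} \<times> {0..1} \<times> UNIV) (\<lambda>(t, r, z). F (t, mer r z))"
    if "continuous_on ?S F" for F :: "real \<times> (real ^ 3) \<Rightarrow> real ^ 3"
    unfolding case_prod_beta'
    by (rule continuous_on_compose2[OF that])
      (auto intro!: continuous_intros mer)
  have cont_mer_P: "continuous_on ({0..1} \<times> UNIV) (\<lambda>(r, z). F (mer r z))"
    if "continuous_on cylinder F" for F :: "real ^ 3 \<Rightarrow> real"
    unfolding case_prod_beta'
    by (rule continuous_on_compose2[OF that])
      (auto intro!: continuous_intros mer)
  have path_t: "((\<lambda>t. F (t, x)) has_vector_derivative L (1, 0)) (at t within {0..})"
    if "(F has_derivative L) (at (t, x) within ?S)" "x \<in> cylinder"
    for F :: "real \<times> (real ^ 3) \<Rightarrow> real ^ 3" and L t x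
    by (rule has_vector_derivative_along_path[where \<gamma> = "\<lambda>t. (t, x)", OF that(1)])
      (use that in \<open>auto intro!: derivative_eq_intros\<close>)
  have path_r: "((\<lambda>r. F (t, mer r z)) has_vector_derivative L (e 1)) (at r within {0..1})"
    if "(F has_derivative L) (at (t, mer r z) within ?S)" "0 \<le> t"
    for F :: "real \<times> (real ^ 3) \<Rightarrow> real ^ 3" and L t r z
    unfolding e_def
    by (rule has_vector_derivative_along_path[where \<gamma> = "\<lambda>r. (t, mer r z)", OF that(1)])
      (use that mer in \<open>auto intro!: has_vector_derivative_Pair has_vector_derivative_mer has_vector_derivative_const\<close>)
  have path_z: "((\<lambda>z. F (t, mer r z)) has_vector_derivative L (e 3)) (at z)"
    if "(F has_derivative L) (at (t, mer r z) within ?S)" "0 \<le> t" "r \<in> {0..1}"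
    for F :: "real \<times> (real ^ 3) \<Rightarrow> real ^ 3" and L t r z
    unfolding e_def
    by (rule has_vector_derivative_along_path[where \<gamma> = "\<lambda>z. (t, mer r z)", OF that(1)])
      (use that mer in \<open>auto intro!: has_vector_derivative_Pair has_vector_derivative_mer has_vector_derivative_const\<close>)
  let ?ut = "\<lambda>t r z. D (t, mer r z) (1, 0)"
  let ?u = "\<lambda>i t r z. D (t, mer r z) (e i)"
  let ?p = "\<lambda>i t r z. Q t (mer r z) (axis i 1)"
  show thesis
  proof (rule that)
    show "axisymmetric_euler (\<lambda>t r z. U t (mer r z)) ?ut (?u 1) (?u 2) (?u 3)
        (\<lambda>t r z. P t (mer r z)) (?p 1) (?p 3)"
    proof
      show "continuous_on ({0..} \<times> {0..1} \<times> UNIV) (\<lambda>(t, r, z). U t (mer r z))"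
        using cont_mer[OF contG] by simp
      show "continuous_on ({0..} \<times> {0..1} \<times> UNIV) (\<lambda>(t, r, z). ?ut t r z)"
        by (rule cont_mer[OF contD])
      show "continuous_on ({0..} \<times> {0..1} \<times> UNIV) (\<lambda>(t, r, z). ?u 1 t r z)"
        "continuous_on ({0..} \<times> {0..1} \<times> UNIV) (\<lambda>(t, r, z). ?u 2 t r z)"
        "continuous_on ({0..} \<times> {0..1} \<times> UNIV) (\<lambda>(t, r, z). ?u 3 t r z)"
        by (rule cont_mer[OF contD])+
      fix t r z :: real
      assume t: "0 \<le> t"
      \<comment> \<open>This makes the one-sided \<open>vector_derivative\<close> in time well
        determined, also at time 0.\<close>
      have limpt: "t islimpt {0..}"
        by (rule islimpt_subset[OF islimpt_greaterThanLessThan1[of t "t + 1"]]) (use t in auto)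
      from t have tI: "t \<in> time_interval \<infinity>" by (simp add: I)
      show "continuous_on ({0..1} \<times> UNIV) (\<lambda>(r, z). P t (mer r z))"
        "continuous_on ({0..1} \<times> UNIV) (\<lambda>(r, z). ?p 1 t r z)"
        "continuous_on ({0..1} \<times> UNIV) (\<lambda>(r, z). ?p 3 t r z)"
        by (rule cont_mer_P contP contQ t)+
      have "U t (cyl 1 0 z) \<bullet> e_r 0 = 0"
        using sol tI by (simp add: smooth_euler_solution_def)
      then show "U t (mer 1 z) $ 1 = 0"
        by (simp add: e_r_def mer_eq_cyl vec3_inner)
      { assume r: "0 < r" "r \<le> 1"
        then have x: "mer r z \<in> cylinder" by (intro mer) auto
        show "r *\<^sub>R ?u 2 t r z = vector [- (U t (mer r z) $ 2), U t (mer r z) $ 1, 0]"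
          unfolding e_def
          by (rule axisymmetric_field_deriv_\<theta>[OF bspec[OF field tI] r slice[OF t x]])
        have "vector_derivative (\<lambda>s. U s (mer r z)) (at t within {0..}) = ?ut t r z"
          using path_t[OF D, of t "mer r z"] t x
          by (intro vector_derivative_within) (auto simp: trivial_limit_within limpt)
        moreover have "linear (\<lambda>v. D (t, mer r z) (0, v))"
          using slice[OF t x] by (rule has_derivative_linear)
        from linear_vec3[OF this, of "U t (mer r z)"]
        have "advect cylinder (U t) (mer r z) = (U t (mer r z) $ 1) *\<^sub>R ?u 1 t r z
            + (U t (mer r z) $ 2) *\<^sub>R ?u 2 t r z + (U t (mer r z) $ 3) *\<^sub>R ?u 3 t r z"
          by (simp add: advect_def jacobian_def frechet_derivative_cylinder[OF slice[OF t x] x] e_def)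
        moreover have "grad cylinder (P t) (mer r z) = vector [?p 1 t r z, 0, ?p 3 t r z]"
          using grad_vec3[OF Q[OF t x] x]
            axisymmetric_function_deriv_\<theta>[OF bspec[OF pressure tI] r Q[OF t x]] by simp
        moreover have "vector_derivative (\<lambda>s. U s (mer r z)) (at t within {0..})
            + advect cylinder (U t) (mer r z) = - grad cylinder (P t) (mer r z)"
          using sol tI x by (simp add: smooth_euler_solution_def I)
        ultimately show "?ut t r z + ((U t (mer r z) $ 1) *\<^sub>R ?u 1 t r z
            + (U t (mer r z) $ 2) *\<^sub>R ?u 2 t r z + (U t (mer r z) $ 3) *\<^sub>R ?u 3 t r z)
          = - vector [?p 1 t r z, 0, ?p 3 t r z]"
          by simp }
      assume r: "r \<in> {0..1}"
      note x = mer[OF r]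
      have tx: "(t, mer r z) \<in> ?S" using t x by simp
      show "((\<lambda>t. U t (mer r z)) has_vector_derivative ?ut t r z) (at t within {0..})"
        using path_t[OF D[OF tx] x] by simp
      show "((\<lambda>r. U t (mer r z)) has_vector_derivative ?u 1 t r z) (at r within {0..1})"
        using path_r[OF D[OF tx] t] by simp
      show "((\<lambda>z. U t (mer r z)) has_vector_derivative ?u 3 t r z) (at z)"
        using path_z[OF D[OF tx] t r] by simp
      show "((\<lambda>r. P t (mer r z)) has_real_derivative ?p 1 t r z) (at r within {0..1})"
        unfolding has_real_derivative_iff_has_vector_derivative
        by (rule has_vector_derivative_along_path[OF Q[OF t x] has_vector_derivative_mer(1)])
          (use mer in auto)
      show "((\<lambda>z. P t (mer r z)) has_real_derivative ?p 3 t r z) (at z)"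
        unfolding has_real_derivative_iff_has_vector_derivative
        by (rule has_vector_derivative_along_path[OF Q[OF t x] has_vector_derivative_mer(2)])
          (use x mer[OF r] in auto)
      have "divergence cylinder (U t) (mer r z) = 0"
        using sol tI x by (simp add: smooth_euler_solution_def)
      then show "?u 1 t r z $ 1 + ?u 2 t r z $ 2 + ?u 3 t r z $ 3 = 0"
        by (simp add: divergence_vec3[OF slice[OF t x] x] e_def)
      have shift: "mer r (- pi) + (2 * pi) *\<^sub>R e_z = mer r pi"
        by (simp add: mer_def e_z_def vec_eq_iff forall_3 axis_def)
      have "z_periodic (U t)" "z_periodic (P t)"
        using sol tI by (auto simp: smooth_euler_solution_def)
      then show "U t (mer r (- pi)) = U t (mer r pi)" "P t (mer r (- pi)) = P t (mer r pi)"
        using mer[OF r, of "- pi"] by (auto simp: z_periodic_def simp flip: shift)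
    qed
    show "((\<lambda>r. ?u 1 t r 0) has_vector_derivative H (e 1) (t, mer r 0) (e 1)) (at r within {0..1})"
      "((\<lambda>r. ?ut t r 0) has_vector_derivative H (1, 0) (t, mer r 0) (e 1)) (at r within {0..1})"
      if "0 \<le> t" "r \<in> {0..1}" for t r
      using that mer H[of "(t, mer r 0)" "e 1"] H[of "(t, mer r 0)" "(1, 0)"]
        path_r[of "\<lambda>x. D x (e 1)" "H (e 1) (t, mer r 0)" t r 0]
        path_r[of "\<lambda>x. D x (1, 0)" "H (1, 0) (t, mer r 0)" t r 0]
      by auto
    show "continuous_on ({0..1} \<times> {0..}) (\<lambda>(r, t). H (1, 0) (t, mer r 0) (e 1))"
      unfolding case_prod_beta'
      by (rule continuous_on_compose2[OF contH])
        (auto intro!: continuous_intros mer)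
  qed
qed

section \<open>The two blowup criteria\<close>

theorem theorem1p2:
  fixes T :: ereal
    and U\<^sub>0 :: "real ^ 3 \<Rightarrow> real ^ 3"
    and U :: "real \<Rightarrow> real ^ 3 \<Rightarrow> real ^ 3"
    and P :: "real \<Rightarrow> real ^ 3 \<Rightarrow> real"
    and a\<^sub>0 b\<^sub>0 c\<^sub>0 :: "real \<Rightarrow> real \<Rightarrow> real"
    and a b c p :: "real \<Rightarrow> real \<Rightarrow> real \<Rightarrow> real"
    and \<bb>\<^sub>1 \<bb>\<^sub>2 \<aa> \<kappa> :: real
  assumes "maximal_smooth_euler_solution T U\<^sub>0 U P"
    and "\<forall>t\<in>time_interval T. axisymmetric_field (U t) (a t) (b t) (c t)"
    and "\<forall>t\<in>time_interval T. axisymmetric_function (P t) (p t)"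
    and "axisymmetric_field U\<^sub>0 a\<^sub>0 b\<^sub>0 c\<^sub>0"
    and "odd_z c\<^sub>0" and "even_z a\<^sub>0" and "even_z b\<^sub>0"
    and "\<bb>\<^sub>1 = b\<^sub>0 1 0" and "\<bb>\<^sub>2 = d_r b\<^sub>0 1 0"
    and "2 * \<bb>\<^sub>1 * (\<bb>\<^sub>1 + \<bb>\<^sub>2) = - \<kappa>\<^sup>2" and "- \<kappa>\<^sup>2 < 0"
    and "\<aa> = d_r (a 0) 1 0" and "\<aa> < 0"
  shows "(\<forall>k. 0 < k \<and> k * (k + \<aa>) = \<kappa>\<^sup>2 * ln 2 \<and>
              (\<forall>t\<in>time_interval T. - k\<^sup>2 \<le> d_r (d_r (p t)) 1 0 + 3 * \<bb>\<^sub>1\<^sup>2 \<and>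
                            d_r (d_r (p t)) 1 0 + 3 * \<bb>\<^sub>1\<^sup>2 \<le> 0)
            \<longrightarrow> T < \<infinity>)
       \<and> ((\<forall>t\<in>time_interval T. d_r (d_r (p t)) 1 0 + 3 * \<bb>\<^sub>1\<^sup>2 \<ge> 0) \<longrightarrow> T < \<infinity>)"
proof (cases "T = \<infinity>")
  case True
  have I: "time_interval T = {0..}" by (auto simp: time_interval_def True)
  have sol: "smooth_euler_solution \<infinity> U\<^sub>0 U P"
    using assms(1) by (simp add: maximal_smooth_euler_solution_def True)
  obtain ut ur us uz pr pz urr utr where
    flow: "axisymmetric_euler (\<lambda>t r z. U t (mer r z)) ut ur us uz (\<lambda>t r z. P t (mer r z)) pr pz"
    and C2: "\<And>t r. 0 \<le> t \<Longrightarrow> r \<in> {0..1} \<Longrightarrow>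
      ((\<lambda>r. ur t r 0) has_vector_derivative urr t r) (at r within {0..1})"
    "\<And>t r. 0 \<le> t \<Longrightarrow> r \<in> {0..1} \<Longrightarrow>
      ((\<lambda>r. ut t r 0) has_vector_derivative utr t r) (at r within {0..1})"
    "continuous_on ({0..1} \<times> {0..}) (\<lambda>(r, t). utr t r)"
    using smooth_euler_solution_axisymmetric[OF sol assms(2,3)[unfolded True]] by blast
  interpret axisymmetric_euler "\<lambda>t r z. U t (mer r z)" ut ur us uz "\<lambda>t r z. P t (mer r z)" pr pz
    by (rule flow)
  have U0: "U 0 (mer r z) = vector [a\<^sub>0 r z, b\<^sub>0 r z, c\<^sub>0 r z]" if "0 < r" "r \<le> 1" for r z
  proof -
    have "U 0 (mer r z) = U\<^sub>0 (mer r z)"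
      using sol mer_in_cylinder[of r z] that by (simp add: smooth_euler_solution_def)
    also have "\<dots> = vector [a\<^sub>0 r z, b\<^sub>0 r z, c\<^sub>0 r z]"
      using assms(4) that
      by (auto simp: mer_eq_cyl axisymmetric_field_def e_r_def e_\<theta>_def e_z_def vec_eq_iff forall_3)
    finally show ?thesis .
  qed
  have a0: "a 0 r z = U 0 (mer r z) $ 1" if "0 < r" "r \<le> 1" for r z
    using bspec[OF assms(2), of 0] that
    by (auto simp: I mer_eq_cyl axisymmetric_field_def e_r_def e_\<theta>_def e_z_def)
  have even: "U 0 (mer r (- z)) = flip_z (U 0 (mer r z))" if "0 < r" "r \<le> 1" "z \<in> {-pi..pi}" for r z
    using assms(5-7) that by (simp add: U0 flip_z_vector odd_z_def even_z_def)
  have ur: "d_r (\<lambda>r z. U 0 (mer r z) $ i) 1 0 = ur 0 1 0 $ i" for i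
    by (intro d_r_eq has_vector_derivative_vec_nth has_vector_derivative_within_subset[OF deriv_r]) auto
  have "\<bb>\<^sub>1 = U 0 (mer 1 0) $ 2"
    by (simp add: U0 assms(8))
  \<comment> \<open>The component functions are tied to the velocity only for \<open>0 < r\<close>
    and \<open>r \<le> 1\<close>, exactly the radii that \<open>d_r\<close> sees; the same holds for
    \<open>\<aa>\<close> and for the pressure.\<close>
  moreover have "\<bb>\<^sub>2 = ur 0 1 0 $ 2"
    unfolding assms(9) ur[symmetric] by (rule d_r_cong) (auto simp: U0)
  moreover have "\<aa> = ur 0 1 0 $ 1"
    unfolding assms(12) ur[symmetric] by (rule d_r_cong) (auto simp: a0)
  moreover have "d_r (d_r (\<lambda>r z. P t (mer r z))) 1 0 = d_r (d_r (p t)) 1 0" if "0 \<le> t" for t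
    using bspec[OF assms(3), of t] that
    by (intro d_r_cong) (auto simp: I mer_eq_cyl axisymmetric_function_def)
  moreover have "2 * \<bb>\<^sub>1 * (\<bb>\<^sub>1 + \<bb>\<^sub>2) < 0"
    using assms(10,11) by linarith
  ultimately have 1: "\<not> (\<forall>t\<ge>0. 0 \<le> d_r (d_r (p t)) 1 0 + 3 * \<bb>\<^sub>1\<^sup>2)"
    and 2: "\<And>k. 0 < k \<Longrightarrow> k * (k + \<aa>) < - (2 * \<bb>\<^sub>1 * (\<bb>\<^sub>1 + \<bb>\<^sub>2)) \<Longrightarrow>
      \<not> (\<forall>t\<ge>0. - k\<^sup>2 \<le> d_r (d_r (p t)) 1 0 + 3 * \<bb>\<^sub>1\<^sup>2)"
    using no_global_flow[OF even C2] assms(13) by simp_all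
  \<comment> \<open>The equation for \<open>k\<close> becomes the strict inequality that makes the
    growing mode of \<open>\<phi>\<close> negative.\<close>
  have "\<kappa>\<^sup>2 * ln 2 < \<kappa>\<^sup>2"
    using assms(11) ln_2_less_1 by simp
  then have "\<not> (\<forall>t\<ge>0. - k\<^sup>2 \<le> d_r (d_r (p t)) 1 0 + 3 * \<bb>\<^sub>1\<^sup>2)"
    if "0 < k" "k * (k + \<aa>) = \<kappa>\<^sup>2 * ln 2" for k
    using that by (intro 2) (simp_all add: assms(10))
  with 1 show ?thesis
    unfolding I by (metis atLeast_iff)
qed auto

end
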